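(* Let $G$ be a connected topological group, $H$ an abelian group, $n\ge 2$, $\lambda\in H^n(BG;H)$, and let $P\xrightarrow{\pi}M$ be a principal $G$-bundle over a connected CW-complex $M$, classified by $f:M\to BG$. Then: (1) A trivialization $\widetilde f$ of $\lambda$ on $P$ gives a canonical cohomology class $[\widetilde f^*]\in H^{n-1}(P;H)$ that restricts on fibers to the class $\Omega\lambda\in H^{n-1}(G;H)$. (2) The cohomology class in (1) depends only on the homotopy class of $\widetilde f$. (3) The assignment from homotopy classes of trivializations of $\lambda$ on $P$ to $H^{n-1}(P;H)$ is equivariant for the natural actions of $H^{n-1}(M;H)$, where $\phi\in H^{n-1}(M;H)$ acts on $H^{n-1}(P;H)$ by addition of $\pi^*\phi$.
   Context: $G$ is assumed to be of CW type. The class $\lambda$ is represented by a fixed based map $\lambda:BG\to K(H,n)$. For a based space $(Y,y_1)$, $PY=\{\gamma:[0,1]\to Y\mid\gamma(1)=y_1\}$ with fibration $\gamma\mapsto\gamma(0)$. The homotopy fiber of $\lambda$ is $\widetilde{BG}_\lambda=\{(b,\gamma)\in BG\times PK(H,n)\mid\gamma(0)=\lambda(b)\}$ with projection $\Pi:\widetilde{BG}_\lambda\to BG$; $\Omega K(H,n)\simeq K(H,n-1)$ acts on it fiberwise by concatenation. A trivialization of $\lambda$ on $P$ is a lift $\widetilde f:M\to\widetilde{BG}_\lambda$ with $\Pi\circ\widetilde f=f$; two are homotopic if they are homotopic through lifts of $f$. The group $H^{n-1}(M;H)=[M,\Omega K(H,n)]$ acts on homotopy classes of trivializations via the fiberwise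 action of $\Omega K(H,n)$. The canonical class: let $\Pi^*EG\to\widetilde{BG}_\lambda$ be the pullback of the universal bundle $EG\to BG$. A trivialization $\widetilde f$ is the same as a $G$-equivariant map $\widetilde f^*:P\to\Pi^*EG$ covering it and lifting the classifying bundle map $f^*:P\to EG$. Since $EG$ is contractible, the inclusion of the fiber $\Omega K(H,n)$ of $\Pi^*EG\to EG$ over the base point is a homotopy equivalence, so $\Pi^*EG\simeq K(H,n-1)$, and $[\widetilde f^*]\in H^{n-1}(P;H)$ is the class represented by $\widetilde f^*:P\to\Pi^*EG\simeq K(H,n-1)$. The class $\Omega\lambda\in H^{n-1}(G;H)$ is represented by $G\simeq\Omega BG\xrightarrow{\Omega\lambda}\Omega K(H,n)\simeq K(H,n-1)$, where $g\in G$ corresponds to the projection to $BG$ of a path in $EG$ from the base point $e_0$ to $e_0g$. Restriction to fibers is the map $i^*:H^*(P;H)\to H^*(G;H)$ (well-defined because $G$ is connected). *)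

theory Defs
  imports "HOL-Analysis.Analysis" "HOL-Algebra.Elementary_Groups"
begin

section \<open>Homotopy classes\<close>

text \<open>Functions are total, so a class also contains all functions that differ from a
  representative only outside the domain space.\<close>

definition htpy_class ::
  "(('a \<Rightarrow> 'b) \<Rightarrow> bool) \<Rightarrow> 'a topology \<Rightarrow> 'b topology \<Rightarrow> ('a \<Rightarrow> 'b) \<Rightarrow> ('a \<Rightarrow> 'b) set" where
  "htpy_class Q X Y f = {g. homotopic_with Q X Y f g}"

definition htpy_classes ::
  "(('a \<Rightarrow> 'b) \<Rightarrow> bool) \<Rightarrow> 'a topology \<Rightarrow> 'b topology \<Rightarrow> ('a \<Rightarrow> 'b) set set" where
  "htpy_classes Q X Y = {htpy_class Q X Y f | f. continuous_map X Y f \<and> Q f}"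

definition homotopy_inverse ::
  "'a topology \<Rightarrow> 'b topology \<Rightarrow> ('a \<Rightarrow> 'b) \<Rightarrow> ('b \<Rightarrow> 'a) \<Rightarrow> bool" where
  "homotopy_inverse X Y f r \<longleftrightarrow>
     continuous_map X Y f \<and> continuous_map Y X r \<and>
     homotopic_with (\<lambda>_. True) X X (r \<circ> f) id \<and>
     homotopic_with (\<lambda>_. True) Y Y (f \<circ> r) id"

definition htpy_pullback ::
  "'x topology \<Rightarrow> 'y topology \<Rightarrow> ('x \<Rightarrow> 'z) \<Rightarrow> ('z \<Rightarrow> 'y) set \<Rightarrow> ('x \<Rightarrow> 'y) set" where
  "htpy_pullback X Y q U = (\<Union>u\<in>U. htpy_class (\<lambda>_. True) X Y (u \<circ> q))"


section \<open>CW complexes\<close>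

definition disc :: "nat \<Rightarrow> (nat \<Rightarrow> real) set" where
  "disc n = {x \<in> topspace (Euclidean_space n). (\<Sum>i<n. (x i)\<^sup>2) \<le> 1}"

definition open_disc :: "nat \<Rightarrow> (nat \<Rightarrow> real) set" where
  "open_disc n = {x \<in> topspace (Euclidean_space n). (\<Sum>i<n. (x i)\<^sup>2) < 1}"

text \<open>Whitehead's description: \<open>C\<close> is the set of open cells, \<open>d\<close> gives their dimensions and
  \<open>ch\<close> their characteristic maps. The last two clauses are closure-finiteness and the weak
  topology.\<close>

definition CW_complex :: "'a topology \<Rightarrow> bool" where
  "CW_complex X \<longleftrightarrow> Hausdorff_space X \<and>
     (\<exists>(C :: 'a set set) (d :: 'a set \<Rightarrow> nat) (ch :: 'a set \<Rightarrow> (nat \<Rightarrow> real) \<Rightarrow> 'a).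
        disjoint C \<and> \<Union>C = topspace X \<and>
        (\<forall>e\<in>C. continuous_map (subtopology (Euclidean_space (d e)) (disc (d e))) X (ch e) \<and>
               homeomorphic_map (subtopology (Euclidean_space (d e)) (open_disc (d e)))
                 (subtopology X e) (ch e)) \<and>
        (\<forall>e\<in>C. \<exists>F\<subseteq>C. finite F \<and> (\<forall>e'\<in>F. d e' < d e) \<and>
               ch e ` (disc (d e) - open_disc (d e)) \<subseteq> \<Union>F) \<and>
        (\<forall>A\<subseteq>topspace X. closedin X A \<longleftrightarrow> (\<forall>e\<in>C. closedin X (A \<inter> ch e ` disc (d e)))))"


section \<open>Homotopy groups and Eilenberg-MacLane spaces\<close>

definition cube :: "nat \<Rightarrow> (nat \<Rightarrow> real) topology" where
  "cube i = product_topology (\<lambda>_. top_of_set {0..1}) {..<i}"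

definition bdry_to :: "nat \<Rightarrow> 'a \<Rightarrow> ((nat \<Rightarrow> real) \<Rightarrow> 'a) \<Rightarrow> bool" where
  "bdry_to i x0 f \<longleftrightarrow> (\<forall>x\<in>topspace (cube i). (\<exists>j<i. x j = 0 \<or> x j = 1) \<longrightarrow> f x = x0)"

definition cube_concat ::
  "((nat \<Rightarrow> real) \<Rightarrow> 'a) \<Rightarrow> ((nat \<Rightarrow> real) \<Rightarrow> 'a) \<Rightarrow> (nat \<Rightarrow> real) \<Rightarrow> 'a" where
  "cube_concat f g x =
     (if x 0 \<le> 1/2 then f (x(0 := 2 * x 0)) else g (x(0 := 2 * x 0 - 1)))"

text \<open>Only meaningful for \<open>i \<ge> 1\<close>.\<close>

definition homotopy_group :: "nat \<Rightarrow> 'a topology \<Rightarrow> 'a \<Rightarrow> ((nat \<Rightarrow> real) \<Rightarrow> 'a) set monoid" where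
  "homotopy_group i X x0 =
     \<lparr>carrier = htpy_classes (bdry_to i x0) (cube i) X,
      monoid.mult = (\<lambda>U V. \<Union>u\<in>U. \<Union>v\<in>V. htpy_class (bdry_to i x0) (cube i) X (cube_concat u v)),
      one = htpy_class (bdry_to i x0) (cube i) X (\<lambda>_. x0)\<rparr>"

definition eilenberg_maclane ::
  "('h, 'hx) monoid_scheme \<Rightarrow> nat \<Rightarrow> 'k topology \<Rightarrow> 'k \<Rightarrow> bool" where
  "eilenberg_maclane H n K k0 \<longleftrightarrow>
     k0 \<in> topspace K \<and> path_connected_space K \<and>
     homotopy_group n K k0 \<cong> H \<and>
     (\<forall>i\<ge>1. i \<noteq> n \<longrightarrow> trivial_group (homotopy_group i K k0))"


section \<open>Path spaces\<close>

definition compact_open :: "'a topology \<Rightarrow> 'b topology \<Rightarrow> ('a \<Rightarrow> 'b) topology" where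
  "compact_open X Y = topology_generated_by
     {{f \<in> extensional (topspace X). continuous_map X Y f \<and> f ` C \<subseteq> U} | C U.
        compactin X C \<and> openin Y U}"

abbreviation path_space :: "'a topology \<Rightarrow> (real \<Rightarrow> 'a) topology" where
  "path_space Y \<equiv> compact_open (top_of_set {0..1}) Y"

text \<open>The base point is the end point of the paths.\<close>

definition based_paths :: "'a topology \<Rightarrow> 'a \<Rightarrow> (real \<Rightarrow> 'a) topology" where
  "based_paths Y y1 = subtopology (path_space Y) {\<gamma>. \<gamma> 1 = y1}"

definition loop_space :: "'a topology \<Rightarrow> 'a \<Rightarrow> (real \<Rightarrow> 'a) topology" where
  "loop_space Y y1 = subtopology (path_space Y) {\<gamma>. \<gamma> 0 = y1 \<and> \<gamma> 1 = y1}"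

definition path_concat :: "(real \<Rightarrow> 'a) \<Rightarrow> (real \<Rightarrow> 'a) \<Rightarrow> real \<Rightarrow> 'a" where
  "path_concat \<gamma> \<delta> = restrict (\<lambda>t. if t \<le> 1/2 then \<gamma> (2 * t) else \<delta> (2 * t - 1)) {0..1}"

definition const_path :: "'a \<Rightarrow> real \<Rightarrow> 'a" where
  "const_path y = restrict (\<lambda>_. y) {0..1}"

definition map_path :: "('a \<Rightarrow> 'b) \<Rightarrow> (real \<Rightarrow> 'a) \<Rightarrow> real \<Rightarrow> 'b" where
  "map_path h \<gamma> = restrict (h \<circ> \<gamma>) {0..1}"

text \<open>For \<open>K\<close> a \<open>K(H,n)\<close>, this is \<open>H\<^sup>n\<^sup>-\<^sup>1(X;H) = [X, \<Omega>K(H,n)]\<close> (free homotopy classes) for spaces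
  \<open>X\<close> of CW type, written multiplicatively; the group law is pointwise concatenation of loops.\<close>

definition cohomology ::
  "'k topology \<Rightarrow> 'k \<Rightarrow> 'x topology \<Rightarrow> ('x \<Rightarrow> real \<Rightarrow> 'k) set monoid" where
  "cohomology K k0 X =
     \<lparr>carrier = htpy_classes (\<lambda>_. True) X (loop_space K k0),
      monoid.mult = (\<lambda>U V. \<Union>u\<in>U. \<Union>v\<in>V.
         htpy_class (\<lambda>_. True) X (loop_space K k0) (\<lambda>x. path_concat (u x) (v x))),
      one = htpy_class (\<lambda>_. True) X (loop_space K k0) (\<lambda>_. const_path k0)\<rparr>"


section \<open>Principal bundles\<close>

definition topological_group :: "('g, 'gx) monoid_scheme \<Rightarrow> 'g topology \<Rightarrow> bool" where
  "topological_group G TG \<longleftrightarrow> group G \<and> topspace TG = carrier G \<and>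
     continuous_map (prod_topology TG TG) TG (\<lambda>(x, y). x \<otimes>\<^bsub>G\<^esub> y) \<and>
     continuous_map TG TG (m_inv G)"

definition principal_bundle ::
  "('g, 'gx) monoid_scheme \<Rightarrow> 'g topology \<Rightarrow> 'p topology \<Rightarrow> ('p \<Rightarrow> 'g \<Rightarrow> 'p) \<Rightarrow>
   'm topology \<Rightarrow> ('p \<Rightarrow> 'm) \<Rightarrow> bool" where
  "principal_bundle G TG P act M \<pi> \<longleftrightarrow>
     continuous_map P M \<pi> \<and>
     continuous_map (prod_topology P TG) P (\<lambda>(x, g). act x g) \<and>
     (\<forall>x\<in>topspace P. act x \<one>\<^bsub>G\<^esub> = x \<and>
        (\<forall>g\<in>carrier G. \<forall>h\<in>carrier G. act (act x g) h = act x (g \<otimes>\<^bsub>G\<^esub> h))) \<and>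
     (\<forall>m\<in>topspace M. \<exists>U \<phi>. openin M U \<and> m \<in> U \<and>
        homeomorphic_map (prod_topology (subtopology M U) TG)
          (subtopology P {x \<in> topspace P. \<pi> x \<in> U}) \<phi> \<and>
        (\<forall>u\<in>U. \<forall>g\<in>carrier G. \<pi> (\<phi> (u, g)) = u \<and>
           (\<forall>h\<in>carrier G. \<phi> (u, g \<otimes>\<^bsub>G\<^esub> h) = act (\<phi> (u, g)) h)))"

definition universal_bundle ::
  "('g, 'gx) monoid_scheme \<Rightarrow> 'g topology \<Rightarrow> 'e topology \<Rightarrow> ('e \<Rightarrow> 'g \<Rightarrow> 'e) \<Rightarrow>
   'b topology \<Rightarrow> ('e \<Rightarrow> 'b) \<Rightarrow> bool" where
  "universal_bundle G TG EG actE BG p \<longleftrightarrow>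
     principal_bundle G TG EG actE BG p \<and> contractible_space EG"

text \<open>\<open>f\<close> classifies \<open>P\<close> by way of the bundle map \<open>F\<close> (written \<open>f\<^sup>*\<close> in the literature).\<close>

definition classified_by ::
  "('g, 'gx) monoid_scheme \<Rightarrow> 'p topology \<Rightarrow> ('p \<Rightarrow> 'g \<Rightarrow> 'p) \<Rightarrow> 'm topology \<Rightarrow> ('p \<Rightarrow> 'm) \<Rightarrow>
   'e topology \<Rightarrow> ('e \<Rightarrow> 'g \<Rightarrow> 'e) \<Rightarrow> 'b topology \<Rightarrow> ('e \<Rightarrow> 'b) \<Rightarrow> ('m \<Rightarrow> 'b) \<Rightarrow> ('p \<Rightarrow> 'e) \<Rightarrow> bool" where
  "classified_by G P act M \<pi> EG actE BG p f F \<longleftrightarrow>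
     continuous_map M BG f \<and> continuous_map P EG F \<and>
     (\<forall>x\<in>topspace P. p (F x) = f (\<pi> x) \<and> (\<forall>g\<in>carrier G. F (act x g) = actE (F x) g))"


section \<open>Trivializations\<close>

definition homotopy_fiber ::
  "'b topology \<Rightarrow> ('b \<Rightarrow> 'k) \<Rightarrow> 'k topology \<Rightarrow> 'k \<Rightarrow> ('b \<times> (real \<Rightarrow> 'k)) topology" where
  "homotopy_fiber BG lam K k0 =
     subtopology (prod_topology BG (based_paths K k0)) {(b, \<gamma>). \<gamma> 0 = lam b}"

definition is_lift :: "'m topology \<Rightarrow> ('m \<Rightarrow> 'b) \<Rightarrow> ('m \<Rightarrow> 'b \<times> (real \<Rightarrow> 'k)) \<Rightarrow> bool" where
  "is_lift M f s \<longleftrightarrow> (\<forall>m\<in>topspace M. fst (s m) = f m)"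

definition trivialization ::
  "'m topology \<Rightarrow> ('m \<Rightarrow> 'b) \<Rightarrow> 'b topology \<Rightarrow> ('b \<Rightarrow> 'k) \<Rightarrow> 'k topology \<Rightarrow> 'k \<Rightarrow>
   ('m \<Rightarrow> 'b \<times> (real \<Rightarrow> 'k)) \<Rightarrow> bool" where
  "trivialization M f BG lam K k0 s \<longleftrightarrow>
     continuous_map M (homotopy_fiber BG lam K k0) s \<and> is_lift M f s"

definition triv_homotopic ::
  "'m topology \<Rightarrow> ('m \<Rightarrow> 'b) \<Rightarrow> 'b topology \<Rightarrow> ('b \<Rightarrow> 'k) \<Rightarrow> 'k topology \<Rightarrow> 'k \<Rightarrow>
   ('m \<Rightarrow> 'b \<times> (real \<Rightarrow> 'k)) \<Rightarrow> ('m \<Rightarrow> 'b \<times> (real \<Rightarrow> 'k)) \<Rightarrow> bool" where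
  "triv_homotopic M f BG lam K k0 = homotopic_with (is_lift M f) M (homotopy_fiber BG lam K k0)"

definition triv_classes ::
  "'m topology \<Rightarrow> ('m \<Rightarrow> 'b) \<Rightarrow> 'b topology \<Rightarrow> ('b \<Rightarrow> 'k) \<Rightarrow> 'k topology \<Rightarrow> 'k \<Rightarrow>
   ('m \<Rightarrow> 'b \<times> (real \<Rightarrow> 'k)) set set" where
  "triv_classes M f BG lam K k0 = htpy_classes (is_lift M f) M (homotopy_fiber BG lam K k0)"

definition fiber_act :: "'b \<times> (real \<Rightarrow> 'k) \<Rightarrow> (real \<Rightarrow> 'k) \<Rightarrow> 'b \<times> (real \<Rightarrow> 'k)" where
  "fiber_act z \<omega> = (fst z, path_concat (snd z) \<omega>)"

definition triv_act ::
  "'m topology \<Rightarrow> ('m \<Rightarrow> 'b) \<Rightarrow> 'b topology \<Rightarrow> ('b \<Rightarrow> 'k) \<Rightarrow> 'k topology \<Rightarrow> 'k \<Rightarrow>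
   ('m \<Rightarrow> real \<Rightarrow> 'k) set \<Rightarrow> ('m \<Rightarrow> 'b \<times> (real \<Rightarrow> 'k)) set \<Rightarrow> ('m \<Rightarrow> 'b \<times> (real \<Rightarrow> 'k)) set" where
  "triv_act M f BG lam K k0 \<Phi> T = (\<Union>\<phi>\<in>\<Phi>. \<Union>s\<in>T.
     htpy_class (is_lift M f) M (homotopy_fiber BG lam K k0) (\<lambda>m. fiber_act (s m) (\<phi> m)))"


section \<open>The canonical class\<close>

definition pullback_EG ::
  "'e topology \<Rightarrow> ('e \<Rightarrow> 'b) \<Rightarrow> 'b topology \<Rightarrow> ('b \<Rightarrow> 'k) \<Rightarrow> 'k topology \<Rightarrow> 'k \<Rightarrow>
   (('b \<times> (real \<Rightarrow> 'k)) \<times> 'e) topology" where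
  "pullback_EG EG p BG lam K k0 =
     subtopology (prod_topology (homotopy_fiber BG lam K k0) EG) {(z, e). fst z = p e}"

text \<open>Inclusion of \<open>\<Omega>K\<close> as the fiber of the pullback over the base point \<open>e0\<close> of \<open>EG\<close>.\<close>

definition fiber_incl :: "('e \<Rightarrow> 'b) \<Rightarrow> 'e \<Rightarrow> (real \<Rightarrow> 'k) \<Rightarrow> ('b \<times> (real \<Rightarrow> 'k)) \<times> 'e" where
  "fiber_incl p e0 \<omega> = ((p e0, \<omega>), e0)"

text \<open>The equivariant map covering the trivialization \<open>s\<close> and lifting the bundle map \<open>F\<close>.\<close>

definition equivariant_lift ::
  "('p \<Rightarrow> 'm) \<Rightarrow> ('p \<Rightarrow> 'e) \<Rightarrow> ('m \<Rightarrow> 'b \<times> (real \<Rightarrow> 'k)) \<Rightarrow> 'p \<Rightarrow> ('b \<times> (real \<Rightarrow> 'k)) \<times> 'e" where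
  "equivariant_lift \<pi> F s x = (s (\<pi> x), F x)"

text \<open>The union over all homotopy inverses \<open>r\<close> of the fiber inclusion avoids a choice; it is a
  single homotopy class because homotopy inverses exist and are unique up to homotopy.\<close>

definition canonical_class ::
  "'p topology \<Rightarrow> ('p \<Rightarrow> 'm) \<Rightarrow> 'e topology \<Rightarrow> 'e \<Rightarrow> ('e \<Rightarrow> 'b) \<Rightarrow> 'b topology \<Rightarrow> ('b \<Rightarrow> 'k) \<Rightarrow>
   'k topology \<Rightarrow> 'k \<Rightarrow> ('p \<Rightarrow> 'e) \<Rightarrow> ('m \<Rightarrow> 'b \<times> (real \<Rightarrow> 'k)) \<Rightarrow> ('p \<Rightarrow> real \<Rightarrow> 'k) set" where
  "canonical_class P \<pi> EG e0 p BG lam K k0 F s =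
     (\<Union>r \<in> {r. homotopy_inverse (loop_space K k0) (pullback_EG EG p BG lam K k0)
                  (fiber_incl p e0) r}.
        htpy_class (\<lambda>_. True) P (loop_space K k0) (r \<circ> equivariant_lift \<pi> F s))"

text \<open>The induced assignment on homotopy classes \<open>T\<close> of trivializations.\<close>

definition canonical_assignment ::
  "'p topology \<Rightarrow> ('p \<Rightarrow> 'm) \<Rightarrow> 'e topology \<Rightarrow> 'e \<Rightarrow> ('e \<Rightarrow> 'b) \<Rightarrow> 'b topology \<Rightarrow> ('b \<Rightarrow> 'k) \<Rightarrow>
   'k topology \<Rightarrow> 'k \<Rightarrow> ('p \<Rightarrow> 'e) \<Rightarrow> ('m \<Rightarrow> 'b \<times> (real \<Rightarrow> 'k)) set \<Rightarrow> ('p \<Rightarrow> real \<Rightarrow> 'k) set" where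
  "canonical_assignment P \<pi> EG e0 p BG lam K k0 F T =
     (\<Union>s\<in>T. canonical_class P \<pi> EG e0 p BG lam K k0 F s)"

text \<open>A continuous choice \<open>c\<close> of paths from \<open>e0\<close> to \<open>e0g\<close> in \<open>EG\<close>; projecting them to \<open>BG\<close>
  is the equivalence of \<open>G\<close> with \<open>\<Omega>BG\<close>, which does not depend on \<open>c\<close> up to homotopy.\<close>

definition orbit_paths ::
  "'g topology \<Rightarrow> 'e topology \<Rightarrow> ('e \<Rightarrow> 'g \<Rightarrow> 'e) \<Rightarrow> 'e \<Rightarrow> ('g \<Rightarrow> real \<Rightarrow> 'e) \<Rightarrow> bool" where
  "orbit_paths TG EG actE e0 c \<longleftrightarrow> continuous_map TG (path_space EG) c \<and>
     (\<forall>g\<in>topspace TG. c g 0 = e0 \<and> c g 1 = actE e0 g)"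

definition Omega_class ::
  "'g topology \<Rightarrow> 'e topology \<Rightarrow> ('e \<Rightarrow> 'g \<Rightarrow> 'e) \<Rightarrow> 'e \<Rightarrow> ('e \<Rightarrow> 'b) \<Rightarrow> ('b \<Rightarrow> 'k) \<Rightarrow>
   'k topology \<Rightarrow> 'k \<Rightarrow> ('g \<Rightarrow> real \<Rightarrow> 'k) set" where
  "Omega_class TG EG actE e0 p lam K k0 =
     (\<Union>c \<in> {c. orbit_paths TG EG actE e0 c}.
        htpy_class (\<lambda>_. True) TG (loop_space K k0) (\<lambda>g. map_path lam (map_path p (c g))))"

end

theory Submission
  imports Defs
begin

text \<open>Write \<open>Q\<close> for \<open>pullback_EG\<close>, the space of pairs of a point \<open>e\<close> of \<open>EG\<close> and a path \<open>\<gamma>\<close>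
  from \<open>lam (p e)\<close> to \<open>k0\<close>, and \<open>L\<close> for \<open>\<Omega>K\<close>, its fiber over \<open>e0\<close>. The whole proof takes place
  in \<open>Q\<close>. A contraction of \<open>EG\<close> provides a path \<open>C e\<close> from \<open>e0\<close> to every \<open>e\<close>, continuously in
  \<open>e\<close>, and \<open>(e, \<gamma>) \<mapsto> (lam \<circ> p \<circ> C e) \<cdot> \<gamma>\<close> is a homotopy inverse \<open>r\<close> of the inclusion of \<open>L\<close>
  (\<open>homotopy_inverse_fiber_incl_exists\<close>). After this, only the fact that \<open>r\<close> is such an inverse
  is used, never its formula. Since homotopy inverses are unique up to homotopy, the canonical
  class is the class of \<open>r \<circ> E s\<close>, where \<open>E s : P \<rightarrow> Q\<close> is the equivariant lift of the
  trivialization \<open>s\<close>. Homotopic trivializations have homotopic equivariant lifts, which gives (2).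

  Two actions on \<open>Q\<close> give the rest: \<open>G\<close> acts through \<open>EG\<close>, and loops act by concatenation.
  Restricting the canonical class to the fiber through \<open>x0\<close> means applying \<open>r\<close> to the orbit map
  \<open>g \<mapsto> q g\<close> of the point \<open>q = E s x0\<close>. The homotopy class of an orbit map does not change when
  \<open>q\<close> moves along a path. The homotopy from \<open>incl \<circ> r\<close> to the identity connects \<open>q\<close> to a loop in
  the fiber \<open>L\<close>, and as \<open>n \<ge> 2\<close> makes \<open>K\<close> simply connected, this loop can be contracted. So every
  orbit map is homotopic to that of the constant loop (\<open>orbits_homotopic_to_base_orbit\<close>). On the
  other hand, if \<open>c g\<close> is a path from \<open>e0\<close> to \<open>e0 g\<close>, then sliding along \<open>c g\<close> while cutting off
  the part of \<open>lam \<circ> p \<circ> c g\<close> already passed moves the loop \<open>lam \<circ> p \<circ> c g\<close> in the fiber to the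
  point \<open>e0 g\<close> with a constant path. This identifies \<open>\<Omega>\<lambda>\<close> with the class of the same orbit map
  (\<open>Omega_class_eq\<close>), which proves (1).

  For (3), the inclusion of \<open>L\<close> turns concatenation into the action of loops on \<open>Q\<close> on the
  nose, so its homotopy inverse \<open>r\<close> does so up to homotopy (\<open>homotopy_inverse_loop_act\<close>): acting on
  \<open>s\<close> by \<open>\<phi>\<close> adds \<open>\<phi> \<circ> \<pi>\<close> to \<open>r \<circ> E s\<close>.\<close>


section \<open>Homotopy classes\<close>

lemma homotopic_withI:
  assumes "continuous_map (prod_topology (top_of_set {0..1::real}) X) Y (\<lambda>z. h (fst z) (snd z))"
    and "\<And>x. x \<in> topspace X \<Longrightarrow> h 0 x = f x" and "\<And>x. x \<in> topspace X \<Longrightarrow> h 1 x = g x"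
    and "\<And>t. t \<in> {0..1} \<Longrightarrow> Q (h t)"
    and cong: "\<And>u v. (\<And>x. x \<in> topspace X \<Longrightarrow> u x = v x) \<Longrightarrow> Q u \<longleftrightarrow> Q v"
  shows "homotopic_with Q X Y f g"
proof -
  have "\<exists>k. continuous_map (prod_topology (top_of_set {0..1::real}) X) Y k \<and>
      (\<forall>x\<in>topspace X. k (0, x) = f x) \<and> (\<forall>x\<in>topspace X. k (1, x) = g x) \<and>
      (\<forall>t\<in>{0..1}. Q (\<lambda>x. k (t, x)))"
    by (rule exI[of _ "\<lambda>z. h (fst z) (snd z)"]) (simp add: assms(1-4))
  then show ?thesis
    by (subst homotopic_with[OF cong]) auto
qed

lemmas homotopic_mapsI = homotopic_withI[where Q = "\<lambda>_. True", OF _ _ _ TrueI refl]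

lemma homotopic_withE:
  assumes "homotopic_with Q X Y f g"
  obtains h where "continuous_map (prod_topology (top_of_set {0..1}) X) Y (\<lambda>z. h (fst z) (snd z))"
    and "h 0 = f" and "h 1 = g" and "\<And>t. t \<in> {0..1::real} \<Longrightarrow> Q (h t)"
proof -
  obtain k :: "real \<times> 'a \<Rightarrow> 'b" where k: "continuous_map (prod_topology (top_of_set {0..1}) X) Y k"
    "\<forall>x. k (0, x) = f x" "\<forall>x. k (1, x) = g x" "\<forall>t\<in>{0..1}. Q (\<lambda>x. k (t, x))"
    using assms unfolding homotopic_with_def by blast
  show ?thesis
    by (rule that[of "\<lambda>t x. k (t, x)"]) (use k in \<open>simp_all add: fun_eq_iff\<close>)
qed

lemma homotopic_comp:
  assumes "continuous_map Y V w" and "homotopic_with (\<lambda>_. True) X Y f g"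
  shows "homotopic_with (\<lambda>_. True) X V (\<lambda>x. w (f x)) (\<lambda>x. w (g x))"
  using homotopic_with_compose_continuous_map_left[OF assms(2,1)] by (simp add: o_def)

lemma homotopic_precomp:
  assumes "homotopic_with (\<lambda>_. True) Y V f g" and "continuous_map X Y w"
  shows "homotopic_with (\<lambda>_. True) X V (\<lambda>x. f (w x)) (\<lambda>x. g (w x))"
  using homotopic_with_compose_continuous_map_right[OF assms] by (simp add: o_def)

lemma htpy_class_eqI:
  assumes "homotopic_with Q X Y f g"
  shows "htpy_class Q X Y f = htpy_class Q X Y g"
  using assms homotopic_with_trans homotopic_with_symD unfolding htpy_class_def by blast

text \<open>The operations on homotopy classes are unions over representatives. This reduces each of
  them to a single representative.\<close>

lemma UN_htpy_class_eq:
  assumes "continuous_map X Y f" and "Q f"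
    and "\<And>u. homotopic_with Q X Y f u \<Longrightarrow> A u = B"
  shows "(\<Union>u\<in>htpy_class Q X Y f. A u) = B"
proof -
  have "f \<in> htpy_class Q X Y f"
    using assms(1,2) by (simp add: htpy_class_def)
  then show ?thesis
    using assms(3) unfolding htpy_class_def by blast
qed

lemma htpy_pullback_class:
  assumes "continuous_map X Z q" and "continuous_map Z Y f"
  shows "htpy_pullback X Y q (htpy_class (\<lambda>_. True) Z Y f) = htpy_class (\<lambda>_. True) X Y (f \<circ> q)"
  unfolding htpy_pullback_def
proof (rule UN_htpy_class_eq[OF assms(2)])
  fix u assume "homotopic_with (\<lambda>_. True) Z Y f u"
  then show "htpy_class (\<lambda>_. True) X Y (u \<circ> q) = htpy_class (\<lambda>_. True) X Y (f \<circ> q)"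
    using assms(1) by (intro htpy_class_eqI homotopic_with_compose_continuous_map_right)
      (auto intro: homotopic_with_symD)
qed simp

lemma homotopy_inverse_unique:
  assumes r: "homotopy_inverse X Y f r" and r': "homotopy_inverse X Y f r'"
  shows "homotopic_with (\<lambda>_. True) Y X r r'"
proof -
  have "homotopic_with (\<lambda>_. True) Y X (r \<circ> (f \<circ> r')) (r \<circ> id)"
    using r r' unfolding homotopy_inverse_def
    by (intro homotopic_with_compose_continuous_map_left[where ?X2.0=Y]) auto
  moreover have "homotopic_with (\<lambda>_. True) Y X ((r \<circ> f) \<circ> r') (id \<circ> r')"
    using r r' unfolding homotopy_inverse_def
    by (intro homotopic_with_compose_continuous_map_right[where ?X2.0=X]) auto
  ultimately show ?thesis
    using homotopic_with_symD homotopic_with_trans by (fastforce simp: o_assoc)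
qed


section \<open>Path spaces\<close>

text \<open>The full space is itself subbasic: take both \<open>C\<close> and \<open>U\<close> empty.\<close>

lemma topspace_compact_open:
  "topspace (compact_open X Y) = {f \<in> extensional (topspace X). continuous_map X Y f}" (is "?L = ?R")
proof
  show "?L \<subseteq> ?R"
    unfolding compact_open_def topology_generated_by_topspace by blast
  have "?R = {f \<in> extensional (topspace X). continuous_map X Y f \<and> f ` {} \<subseteq> {}}"
    by simp
  then show "?R \<subseteq> ?L"
    unfolding compact_open_def topology_generated_by_topspace
    using compactin_empty openin_empty by blast
qed

text \<open>One half of the exponential law. If \<open>w z\<close> maps the compact set \<open>C\<close> into \<open>U\<close>, then by the tube
  lemma so does \<open>w z'\<close> for all \<open>z'\<close> near \<open>z\<close>.\<close>

lemma continuous_map_into_compact_open: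
  assumes w: "continuous_map (prod_topology Z X) Y (\<lambda>y. w (fst y) (snd y))"
    and ext: "\<And>z. z \<in> topspace Z \<Longrightarrow> w z \<in> extensional (topspace X)"
  shows "continuous_map Z (compact_open X Y) w"
proof -
  have cont: "continuous_map X Y (w z)" if "z \<in> topspace Z" for z
    using continuous_map_o_Pair[OF w that] by (simp add: o_def)
  show ?thesis
    unfolding compact_open_def
  proof (rule continuous_on_generated_topo)
    fix S assume "S \<in> {{f \<in> extensional (topspace X). continuous_map X Y f \<and> f ` C \<subseteq> U} | C U.
        compactin X C \<and> openin Y U}"
    then obtain C U where S: "S = {f \<in> extensional (topspace X). continuous_map X Y f \<and> f ` C \<subseteq> U}"
      and C: "compactin X C" and U: "openin Y U" by blast
    let ?W = "{y \<in> topspace (prod_topology Z X). w (fst y) (snd y) \<in> U}"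
    have W: "openin (prod_topology Z X) ?W"
      using openin_continuous_map_preimage[OF w U] .
    show "openin Z (w -` S \<inter> topspace Z)"
    proof (subst openin_subopen, intro ballI)
      fix z assume "z \<in> w -` S \<inter> topspace Z"
      then have z: "z \<in> topspace Z" and "{z} \<times> C \<subseteq> ?W"
        using S compactin_subset_topspace[OF C] by auto
      from tube_lemma_right[OF W C this] obtain N V where
        NV: "openin Z N" "z \<in> N" "C \<subseteq> V" "N \<times> V \<subseteq> ?W" by blast
      have "N \<subseteq> w -` S \<inter> topspace Z"
      proof
        fix z' assume "z' \<in> N"
        then have z': "z' \<in> topspace Z" and "{z'} \<times> C \<subseteq> ?W"
          using openin_subset[OF NV(1)] NV(3,4) by blast+
        then have "w z' ` C \<subseteq> U"
          by auto
        then show "z' \<in> w -` S \<inter> topspace Z"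
          using S cont ext z' by simp
      qed
      with NV show "\<exists>T. openin Z T \<and> z \<in> T \<and> T \<subseteq> w -` S \<inter> topspace Z" by blast
    qed
  next
    show "w ` topspace Z \<subseteq> \<Union>{{f \<in> extensional (topspace X). continuous_map X Y f \<and> f ` C \<subseteq> U} | C U.
        compactin X C \<and> openin Y U}"
      using topspace_compact_open[of X Y] cont ext
      unfolding compact_open_def topology_generated_by_topspace by blast
  qed
qed

text \<open>The other half. A point of \<open>X\<close> has a compact neighbourhood \<open>C\<close> inside any open set containing it,
  and the maps sending \<open>C\<close> into \<open>U\<close> form an open set.\<close>

lemma continuous_map_compact_open_eval:
  assumes X: "locally_compact_space X" "Hausdorff_space X"
    and w: "continuous_map Z (compact_open X Y) w" and a: "continuous_map Z X a"
  shows "continuous_map Z Y (\<lambda>z. w z (a z))"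
  unfolding continuous_map
proof (intro conjI allI impI)
  have cont: "continuous_map X Y (w z)" if "z \<in> topspace Z" for z
    using continuous_map_funspace[OF w] that topspace_compact_open by blast
  show "(\<lambda>z. w z (a z)) ` topspace Z \<subseteq> topspace Y"
    using continuous_map_funspace[OF cont] continuous_map_funspace[OF a] by blast
  fix U assume U: "openin Y U"
  show "openin Z {z \<in> topspace Z. w z (a z) \<in> U}"
  proof (subst openin_subopen, intro ballI)
    fix z assume z: "z \<in> {z \<in> topspace Z. w z (a z) \<in> U}"
    have "openin X {x \<in> topspace X. w z x \<in> U}"
      using openin_continuous_map_preimage[OF cont U] z by simp
    moreover have "a z \<in> {x \<in> topspace X. w z x \<in> U}"
      using z continuous_map_funspace[OF a] by blast
    moreover have "neighbourhood_base_of (compactin X) X"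
      using X locally_compact_space_neighbourhood_base by blast
    ultimately obtain N C where N: "openin X N" "compactin X C" "a z \<in> N" "N \<subseteq> C"
      "C \<subseteq> {x \<in> topspace X. w z x \<in> U}"
      unfolding neighbourhood_base_of by meson
    let ?S = "{f \<in> extensional (topspace X). continuous_map X Y f \<and> f ` C \<subseteq> U}"
    have "openin (compact_open X Y) ?S"
      unfolding compact_open_def using N(2) U by (intro topology_generated_by_Basis) blast
    then have 1: "openin Z {z' \<in> topspace Z. w z' \<in> ?S}"
      by (rule openin_continuous_map_preimage[OF w])
    have 2: "openin Z {z' \<in> topspace Z. a z' \<in> N}"
      by (rule openin_continuous_map_preimage[OF a N(1)])
    have "w z \<in> topspace (compact_open X Y)"
      using continuous_map_funspace[OF w] z by blast
    then have "z \<in> {z' \<in> topspace Z. w z' \<in> ?S} \<inter> {z' \<in> topspace Z. a z' \<in> N}"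
      using z N topspace_compact_open by blast
    moreover have "{z' \<in> topspace Z. w z' \<in> ?S} \<inter> {z' \<in> topspace Z. a z' \<in> N}
        \<subseteq> {z \<in> topspace Z. w z (a z) \<in> U}"
      using N by blast
    ultimately show "\<exists>T. openin Z T \<and> z \<in> T \<and> T \<subseteq> {z \<in> topspace Z. w z (a z) \<in> U}"
      using openin_Int[OF 1 2] by blast
  qed
qed

lemma continuous_map_into_path_space:
  assumes "continuous_map (prod_topology Z (top_of_set {0..1})) Y (\<lambda>y. w (fst y) (snd y))"
    and "\<And>z. z \<in> topspace Z \<Longrightarrow> w z \<in> extensional {0..1}"
  shows "continuous_map Z (path_space Y) w"
  by (rule continuous_map_into_compact_open) (simp_all add: assms)

lemma continuous_map_path_eval:
  assumes "continuous_map Z (path_space Y) w" and "continuous_map Z euclideanreal \<tau>"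
    and "\<And>z. z \<in> topspace Z \<Longrightarrow> 0 \<le> \<tau> z \<and> \<tau> z \<le> 1"
  shows "continuous_map Z Y (\<lambda>z. w z (\<tau> z))"
proof (rule continuous_map_compact_open_eval[where X = "top_of_set {0..1::real}"])
  show "locally_compact_space (top_of_set {0..1::real})"
    by (rule compact_imp_locally_compact_space) (simp add: compact_space_def)
  show "Hausdorff_space (top_of_set {0..1::real})"
    by (rule Hausdorff_space_subtopology[OF Hausdorff_space_euclidean])
  show "continuous_map Z (top_of_set {0..1}) \<tau>"
    using assms by (auto simp: continuous_map_in_subtopology)
qed (rule assms(1))


lemma continuous_map_comp:
  assumes "continuous_map X Y w" and "continuous_map Z X a"
  shows "continuous_map Z Y (\<lambda>z. w (a z))"
  using continuous_map_compose[OF assms(2,1)] by (simp add: o_def)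

lemma continuous_map_ident: "continuous_map X X (\<lambda>x. x)"
  using continuous_map_id by (simp add: id_def)

lemma continuous_map_unit_interval_fst:
  "continuous_map (prod_topology (top_of_set {0..1::real}) X) euclideanreal fst"
  by (rule continuous_map_into_fulltopology[OF continuous_map_fst])

lemma continuous_map_unit_interval_snd:
  "continuous_map (prod_topology X (top_of_set {0..1::real})) euclideanreal snd"
  by (rule continuous_map_into_fulltopology[OF continuous_map_snd])

text \<open>The form in which homotopies are evaluated below: the time may vary with the point.\<close>

lemma continuous_map_homotopy_at:
  assumes "continuous_map (prod_topology (top_of_set {0..1::real}) X) Y (\<lambda>z. h (fst z) (snd z))"
    and "continuous_map Z euclideanreal \<tau>" and "continuous_map Z X a"
    and "\<And>z. z \<in> topspace Z \<Longrightarrow> 0 \<le> \<tau> z \<and> \<tau> z \<le> 1"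
  shows "continuous_map Z Y (\<lambda>z. h (\<tau> z) (a z))"
proof -
  have "continuous_map Z (prod_topology (top_of_set {0..1}) X) (\<lambda>z. (\<tau> z, a z))"
    using assms(2-4) by (auto simp: continuous_map_paired continuous_map_in_subtopology)
  from continuous_map_comp[OF assms(1) this] show ?thesis by simp
qed

lemma path_space_memD:
  assumes "continuous_map Z (path_space Y) w" and "z \<in> topspace Z"
  shows "w z \<in> extensional {0..1}" and "continuous_map (top_of_set {0..1}) Y (w z)"
  using continuous_map_funspace[OF assms(1)] assms(2) by (auto simp: topspace_compact_open Pi_iff)

lemma continuous_map_path_concat:
  assumes u: "continuous_map Z (path_space Y) u" and v: "continuous_map Z (path_space Y) v"
    and uv: "\<And>z. z \<in> topspace Z \<Longrightarrow> u z 1 = v z 0"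
  shows "continuous_map Z (path_space Y) (\<lambda>z. path_concat (u z) (v z))"
proof (rule continuous_map_into_path_space)
  let ?ZI = "prod_topology Z (top_of_set {0..1::real})"
  have "continuous_map ?ZI Y
      (\<lambda>y. if snd y \<le> 1/2 then u (fst y) (2 * snd y) else v (fst y) (2 * snd y - 1))"
  proof (rule continuous_map_cases_le)
    show "continuous_map (subtopology ?ZI {y \<in> topspace ?ZI. snd y \<le> 1/2}) Y (\<lambda>y. u (fst y) (2 * snd y))"
      by (rule continuous_map_path_eval[OF continuous_map_from_subtopology[OF
            continuous_map_comp[OF u continuous_map_fst]] continuous_map_from_subtopology])
        (intro continuous_intros continuous_map_unit_interval_snd, auto)
    show "continuous_map (subtopology ?ZI {y \<in> topspace ?ZI. 1/2 \<le> snd y}) Y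
        (\<lambda>y. v (fst y) (2 * snd y - 1))"
      by (rule continuous_map_path_eval[OF continuous_map_from_subtopology[OF
            continuous_map_comp[OF v continuous_map_fst]] continuous_map_from_subtopology])
        (intro continuous_intros continuous_map_unit_interval_snd, auto)
    show "u (fst y) (2 * snd y) = v (fst y) (2 * snd y - 1)"
      if "y \<in> topspace ?ZI" "snd y = 1/2" for y
      using uv[of "fst y"] that(1) by (simp add: that(2) mem_Times_iff)
  qed (simp_all add: continuous_map_unit_interval_snd)
  then show "continuous_map ?ZI Y (\<lambda>y. path_concat (u (fst y)) (v (fst y)) (snd y))"
    by (rule continuous_map_eq) (auto simp: path_concat_def)
qed (simp add: path_concat_def)

lemma path_concat_extensional [simp]: "path_concat \<gamma> \<delta> \<in> extensional {0..1}"
  by (simp add: path_concat_def)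

lemma path_concat_ends [simp]:
  "path_concat \<gamma> \<delta> 0 = \<gamma> 0" "path_concat \<gamma> \<delta> 1 = \<delta> 1"
  by (simp_all add: path_concat_def)

lemma continuous_map_map_path:
  assumes h: "continuous_map X Y h" and w: "continuous_map Z (path_space X) w"
  shows "continuous_map Z (path_space Y) (\<lambda>z. map_path h (w z))"
proof (rule continuous_map_into_path_space)
  have "continuous_map (prod_topology Z (top_of_set {0..1})) Y (\<lambda>y. h (w (fst y) (snd y)))"
    by (rule continuous_map_comp[OF h], rule continuous_map_path_eval[OF
          continuous_map_comp[OF w continuous_map_fst] continuous_map_unit_interval_snd]) auto
  then show "continuous_map (prod_topology Z (top_of_set {0..1})) Y (\<lambda>y. map_path h (w (fst y)) (snd y))"
    by (rule continuous_map_eq) (auto simp: map_path_def)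
qed (simp add: map_path_def)

lemma continuous_map_const_path:
  assumes "y \<in> topspace Y"
  shows "continuous_map Z (path_space Y) (\<lambda>_. const_path y)"
proof -
  have "const_path y \<in> topspace (path_space Y)"
    using assms by (auto simp: topspace_compact_open const_path_def
      intro: continuous_map_eq[of _ _ "\<lambda>_. y"])
  then show ?thesis by simp
qed

text \<open>The part of \<open>\<gamma>\<close> from time \<open>t\<close> on, reparametrized to the unit interval. Letting \<open>t\<close> grow
  slides the starting point of a path along the path itself while its end point stays fixed. Points
  of \<open>Q\<close> are moved over \<open>EG\<close> in this way.\<close>

definition path_tail :: "real \<Rightarrow> (real \<Rightarrow> 'a) \<Rightarrow> real \<Rightarrow> 'a" where
  "path_tail t \<gamma> = restrict (\<lambda>s. \<gamma> (t + (1 - t) * s)) {0..1}"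

lemma path_tail_ends [simp]: "path_tail t \<gamma> 0 = \<gamma> t" "path_tail t \<gamma> 1 = \<gamma> 1"
  by (simp_all add: path_tail_def)

lemma path_tail_0: "\<gamma> \<in> extensional {0..1} \<Longrightarrow> path_tail 0 \<gamma> = \<gamma>"
  by (auto simp: path_tail_def extensional_def fun_eq_iff)

lemma path_tail_1: "path_tail 1 \<gamma> = const_path (\<gamma> 1)"
  by (auto simp: path_tail_def const_path_def)

lemma path_tail_half_concat:
  assumes "\<delta> \<in> extensional {0..1}" and "\<gamma> 1 = \<delta> 0"
  shows "path_tail (1/2) (path_concat \<gamma> \<delta>) = \<delta>"
proof
  fix s :: real
  consider "s \<notin> {0..1}" | "s = 0" | "0 < s" "s \<le> 1" by force
  then show "path_tail (1/2) (path_concat \<gamma> \<delta>) s = \<delta> s"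
    by cases (use assms in \<open>auto simp: path_tail_def path_concat_def extensional_def field_simps\<close>)
qed

lemma convex_tail_bounds:
  assumes "0 \<le> (t::real)" "t \<le> 1" "0 \<le> s" "s \<le> 1"
  shows "0 \<le> t + (1 - t) * s \<and> t + (1 - t) * s \<le> 1"
proof -
  have "(1 - t) * s \<le> (1 - t) * 1"
    using assms by (intro mult_left_mono) auto
  then show ?thesis using assms by simp
qed

lemma continuous_map_path_tail:
  assumes \<tau>: "continuous_map Z euclideanreal \<tau>" and w: "continuous_map Z (path_space Y) w"
    and "\<And>z. z \<in> topspace Z \<Longrightarrow> 0 \<le> \<tau> z \<and> \<tau> z \<le> 1"
  shows "continuous_map Z (path_space Y) (\<lambda>z. path_tail (\<tau> z) (w z))"
proof (rule continuous_map_into_path_space)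
  have "continuous_map (prod_topology Z (top_of_set {0..1})) Y
      (\<lambda>y. w (fst y) (\<tau> (fst y) + (1 - \<tau> (fst y)) * snd y))"
  proof (rule continuous_map_path_eval[OF continuous_map_comp[OF w continuous_map_fst]])
    show "continuous_map (prod_topology Z (top_of_set {0..1})) euclideanreal
        (\<lambda>y. \<tau> (fst y) + (1 - \<tau> (fst y)) * snd y)"
      by (intro continuous_intros continuous_map_comp[OF \<tau> continuous_map_fst]
          continuous_map_unit_interval_snd)
  next
    fix y assume "y \<in> topspace (prod_topology Z (top_of_set {0..1::real}))"
    then show "0 \<le> \<tau> (fst y) + (1 - \<tau> (fst y)) * snd y \<and> \<tau> (fst y) + (1 - \<tau> (fst y)) * snd y \<le> 1"
      using assms(3)[of "fst y"] by (intro convex_tail_bounds) auto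
  qed
  then show "continuous_map (prod_topology Z (top_of_set {0..1})) Y
      (\<lambda>y. path_tail (\<tau> (fst y)) (w (fst y)) (snd y))"
    by (rule continuous_map_eq) (auto simp: path_tail_def)
qed (simp add: path_tail_def)

lemma continuous_map_loop_space:
  "continuous_map Z (loop_space Y y1) w \<longleftrightarrow>
     continuous_map Z (path_space Y) w \<and> (\<forall>z\<in>topspace Z. w z 0 = y1 \<and> w z 1 = y1)"
  by (auto simp: loop_space_def continuous_map_in_subtopology)


text \<open>A contraction of a space to \<open>x0\<close> may move \<open>x0\<close> around a loop \<open>u\<close>. To reach \<open>x\<close> from \<open>x0\<close>, first
  follow \<open>u\<close> and then the contraction of \<open>x\<close> backwards. For \<open>x = x0\<close> this runs through \<open>u\<close> and back
  again, so it is null-homotopic relative to its end points; \<open>D\<close> records such a null-homotopy.\<close>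

lemma based_contraction:
  assumes "contractible_space X" and x0: "x0 \<in> topspace X"
  obtains C D where "continuous_map X (path_space X) C"
    and "\<And>x. x \<in> topspace X \<Longrightarrow> C x 0 = x0 \<and> C x 1 = x"
    and "continuous_map (top_of_set {0..1::real}) (path_space X) D"
    and "D 0 = C x0" and "D 1 = const_path x0" and "\<And>t. D t 0 = x0 \<and> D t 1 = x0"
proof -
  have "homotopic_with (\<lambda>_. True) X X id (\<lambda>_. x0)"
    using assms by (simp add: contractible_space_alt)
  then obtain h where h: "continuous_map (prod_topology (top_of_set {0..1::real}) X) X (\<lambda>z. h (fst z) (snd z))"
    and h0: "h 0 = id" and h1: "h 1 = (\<lambda>_. x0)"
    by (rule homotopic_withE) (rule that)
  define u where "u = restrict (\<lambda>s. h s x0) {0..1}"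
  define v where "v x = restrict (\<lambda>s. h (1 - s) x) {0..1}" for x
  \<comment> \<open>At stage \<open>t\<close>, run through the part of \<open>u\<close> up to time \<open>1 - t\<close> and back; the absolute value
    describes the turning point at \<open>s = 1/2\<close>.\<close>
  define D where "D t = restrict (\<lambda>s. h ((1 - t) * (1 - \<bar>1 - 2 * s\<bar>)) x0) {0..1}" for t
  show ?thesis
  proof (rule that[of "\<lambda>x. path_concat u (v x)" D])
    show "continuous_map X (path_space X) (\<lambda>x. path_concat u (v x))"
    proof (rule continuous_map_path_concat)
      show "continuous_map X (path_space X) (\<lambda>_. u)"
      proof (rule continuous_map_into_path_space)
        have "continuous_map (prod_topology X (top_of_set {0..1})) X (\<lambda>y. h (snd y) x0)"
          by (rule continuous_map_homotopy_at[OF h continuous_map_unit_interval_snd]) (use x0 in auto)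
        then show "continuous_map (prod_topology X (top_of_set {0..1})) X (\<lambda>y. u (snd y))"
          by (rule continuous_map_eq) (auto simp: u_def)
      qed (simp add: u_def)
      show "continuous_map X (path_space X) v"
      proof (rule continuous_map_into_path_space)
        have "continuous_map (prod_topology X (top_of_set {0..1})) X (\<lambda>y. h (1 - snd y) (fst y))"
          by (rule continuous_map_homotopy_at[OF h _ continuous_map_fst])
            (intro continuous_intros continuous_map_unit_interval_snd, auto)
        then show "continuous_map (prod_topology X (top_of_set {0..1})) X (\<lambda>y. v (fst y) (snd y))"
          by (rule continuous_map_eq) (auto simp: v_def)
      qed (simp add: v_def)
    qed (simp add: u_def v_def h1)
    show "continuous_map (top_of_set {0..1}) (path_space X) D"
    proof (rule continuous_map_into_path_space)
      have "continuous_map (prod_topology (top_of_set {0..1}) (top_of_set {0..1})) X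
          (\<lambda>y. h ((1 - fst y) * (1 - \<bar>1 - 2 * snd y\<bar>)) x0)"
      proof (rule continuous_map_homotopy_at[OF h])
        show "continuous_map (prod_topology (top_of_set {0..1}) (top_of_set {0..1})) euclideanreal
            (\<lambda>y::real \<times> real. (1 - fst y) * (1 - \<bar>1 - 2 * snd y\<bar>))"
          by (intro continuous_intros continuous_map_unit_interval_fst continuous_map_unit_interval_snd)
      qed (use x0 in \<open>auto intro!: mult_le_one\<close>)
      then show "continuous_map (prod_topology (top_of_set {0..1}) (top_of_set {0..1})) X
          (\<lambda>y. D (fst y) (snd y))"
        by (rule continuous_map_eq) (auto simp: D_def)
    qed (simp add: D_def)
    show "D 0 = path_concat u (v x0)"
      by (auto simp: D_def u_def v_def path_concat_def fun_eq_iff abs_if)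
    show "D 1 = const_path x0"
      by (auto simp: D_def const_path_def h0)
  qed (simp_all add: u_def v_def D_def h0)
qed

text \<open>A null-homotopy of maps from the one-dimensional cube, rewritten as a path in the loop space.\<close>

lemma null_loop:
  assumes triv: "trivial_group (homotopy_group 1 K k0)" and \<omega>: "\<omega> \<in> topspace (loop_space K k0)"
  obtains \<eta> where "continuous_map (top_of_set {0..1::real}) (loop_space K k0) \<eta>"
    and "\<eta> 0 = \<omega>" and "\<eta> 1 = const_path k0"
proof -
  have \<omega>K: "\<omega> \<in> extensional {0..1}" "continuous_map (top_of_set {0..1}) K \<omega>" "\<omega> 0 = k0" "\<omega> 1 = k0"
    using \<omega> by (auto simp: loop_space_def topspace_compact_open)
  define u where "u x = \<omega> (x (0::nat))" for x :: "nat \<Rightarrow> real"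
  have u: "continuous_map (cube 1) K u"
    unfolding u_def cube_def
    by (rule continuous_map_comp[OF \<omega>K(2)]) (rule continuous_map_product_projection, simp)
  have "bdry_to 1 k0 u"
    using \<omega>K by (auto simp: bdry_to_def u_def)
  then have "htpy_class (bdry_to 1 k0) (cube 1) K u \<in> carrier (homotopy_group 1 K k0)"
    using u by (auto simp: homotopy_group_def htpy_classes_def)
  then have "htpy_class (bdry_to 1 k0) (cube 1) K u = htpy_class (bdry_to 1 k0) (cube 1) K (\<lambda>_. k0)"
    using triv by (simp add: trivial_group_def) (simp add: homotopy_group_def)
  moreover have "k0 \<in> topspace K"
    using continuous_map_funspace[OF \<omega>K(2)] \<omega>K(3) by auto
  ultimately have "homotopic_with (bdry_to 1 k0) (cube 1) K u (\<lambda>_. k0)"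
    by (simp add: htpy_class_def set_eq_iff bdry_to_def)
  then obtain h where h: "continuous_map (prod_topology (top_of_set {0..1::real}) (cube 1)) K
        (\<lambda>z. h (fst z) (snd z))"
    and h0: "h 0 = u" and h1: "h 1 = (\<lambda>_. k0)" and bd: "\<And>t. t \<in> {0..1} \<Longrightarrow> bdry_to 1 k0 (h t)"
    by (rule homotopic_withE) (rule that)
  \<comment> \<open>The point of the one-dimensional cube with coordinate \<open>s\<close>.\<close>
  define pt :: "real \<Rightarrow> nat \<Rightarrow> real" where "pt s = (\<lambda>i\<in>{..<1}. s)" for s
  have pt: "pt s \<in> topspace (cube 1)" if "s \<in> {0..1}" for s
    using that by (auto simp: pt_def cube_def)
  define \<eta> where "\<eta> t = restrict (\<lambda>s. h t (pt s)) {0..1}" for t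
  have "continuous_map (top_of_set {0..1}) (path_space K) \<eta>"
  proof (rule continuous_map_into_path_space)
    have "continuous_map (prod_topology (top_of_set {0..1}) (top_of_set {0..1})) K
        (\<lambda>y. h (fst y) (pt (snd y)))"
    proof (rule continuous_map_homotopy_at[OF h continuous_map_unit_interval_fst])
      show "continuous_map (prod_topology (top_of_set {0..1}) (top_of_set {0..1})) (cube 1)
          (\<lambda>y::real \<times> real. pt (snd y))"
        unfolding cube_def continuous_map_componentwise
        by (auto simp: pt_def intro!: continuous_intros)
    qed auto
    then show "continuous_map (prod_topology (top_of_set {0..1}) (top_of_set {0..1})) K
        (\<lambda>y. \<eta> (fst y) (snd y))"
      by (rule continuous_map_eq) (auto simp: \<eta>_def)
  qed (simp add: \<eta>_def)
  moreover have "\<eta> t 0 = k0 \<and> \<eta> t 1 = k0" if "t \<in> {0..1}" for t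
    using bd[OF that] pt[of 0] pt[of 1] by (auto simp: bdry_to_def \<eta>_def pt_def)
  ultimately have "continuous_map (top_of_set {0..1}) (loop_space K k0) \<eta>"
    by (simp add: continuous_map_loop_space)
  moreover have "\<eta> 0 = \<omega>"
    using \<omega>K(1) by (auto simp: \<eta>_def h0 u_def pt_def extensional_def fun_eq_iff)
  moreover have "\<eta> 1 = const_path k0"
    by (simp add: \<eta>_def h1 const_path_def)
  ultimately show ?thesis by (rule that)
qed


section \<open>The pulled-back path fibration\<close>

lemma continuous_map_homotopy_fiber:
  "continuous_map Z (homotopy_fiber BG lam K k0) q \<longleftrightarrow>
     continuous_map Z BG (\<lambda>z. fst (q z)) \<and> continuous_map Z (path_space K) (\<lambda>z. snd (q z)) \<and>
     (\<forall>z\<in>topspace Z. snd (q z) 0 = lam (fst (q z)) \<and> snd (q z) 1 = k0)"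
  unfolding homotopy_fiber_def based_paths_def continuous_map_in_subtopology continuous_map_pairwise
  by (auto simp: o_def split_def Pi_iff)

lemma continuous_map_pullback_EG:
  "continuous_map Z (pullback_EG EG p BG lam K k0) q \<longleftrightarrow>
     continuous_map Z (homotopy_fiber BG lam K k0) (\<lambda>z. fst (q z)) \<and>
     continuous_map Z EG (\<lambda>z. snd (q z)) \<and> (\<forall>z\<in>topspace Z. fst (fst (q z)) = p (snd (q z)))"
  unfolding pullback_EG_def continuous_map_in_subtopology continuous_map_pairwise
  by (auto simp: o_def split_def Pi_iff)

lemmas continuous_map_into_pullback = continuous_map_pullback_EG continuous_map_homotopy_fiber

lemma continuous_map_loop_space_path_concat:
  assumes "continuous_map Z (loop_space Y y1) u" and "continuous_map Z (loop_space Y y1) v"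
  shows "continuous_map Z (loop_space Y y1) (\<lambda>z. path_concat (u z) (v z))"
  using assms by (auto simp: continuous_map_loop_space intro!: continuous_map_path_concat)

definition loop_act :: "('b \<times> (real \<Rightarrow> 'k)) \<times> 'e \<Rightarrow> (real \<Rightarrow> 'k) \<Rightarrow> ('b \<times> (real \<Rightarrow> 'k)) \<times> 'e" where
  "loop_act q \<omega> = (fiber_act (fst q) \<omega>, snd q)"

definition group_act :: "('e \<Rightarrow> 'g \<Rightarrow> 'e) \<Rightarrow> 'z \<times> 'e \<Rightarrow> 'g \<Rightarrow> 'z \<times> 'e" where
  "group_act actE q g = (fst q, actE (snd q) g)"

lemma continuous_map_fiber_act:
  assumes "continuous_map Z (homotopy_fiber BG lam K k0) s" and "continuous_map Z (loop_space K k0) \<phi>"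
  shows "continuous_map Z (homotopy_fiber BG lam K k0) (\<lambda>z. fiber_act (s z) (\<phi> z))"
  using assms unfolding continuous_map_homotopy_fiber continuous_map_loop_space
  by (auto simp: fiber_act_def intro!: continuous_map_path_concat)

lemma continuous_map_loop_act:
  assumes "continuous_map Z (pullback_EG EG p BG lam K k0) q" and "continuous_map Z (loop_space K k0) \<phi>"
  shows "continuous_map Z (pullback_EG EG p BG lam K k0) (\<lambda>z. loop_act (q z) (\<phi> z))"
  using assms(1) continuous_map_fiber_act[OF _ assms(2), of BG lam "\<lambda>z. fst (q z)"]
  by (simp add: continuous_map_pullback_EG loop_act_def) (simp add: fiber_act_def)

lemma loop_act_fiber_incl: "loop_act (fiber_incl p e0 \<psi>) \<omega> = fiber_incl p e0 (path_concat \<psi> \<omega>)"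
  by (simp add: loop_act_def fiber_act_def fiber_incl_def)

text \<open>The data of \<open>Q\<close>, which is the pullback along \<open>lam \<circ> p\<close> of the fibration that sends a path ending
  at \<open>k0\<close> to its starting point.\<close>

locale pulled_back_path_fibration =
  fixes EG :: "'e topology" and p :: "'e \<Rightarrow> 'b" and BG :: "'b topology" and lam :: "'b \<Rightarrow> 'k"
    and K :: "'k topology" and k0 :: 'k and e0 :: 'e
  assumes p: "continuous_map EG BG p" and lam: "continuous_map BG K lam"
    and e0: "e0 \<in> topspace EG" and base: "lam (p e0) = k0"
begin

abbreviation "L \<equiv> loop_space K k0"
abbreviation "Q \<equiv> pullback_EG EG p BG lam K k0"
abbreviation "incl \<equiv> fiber_incl p e0"

lemma k0: "k0 \<in> topspace K"
  using continuous_map_funspace[OF lam] continuous_map_funspace[OF p] e0 base by blast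

lemma continuous_map_const_loop: "continuous_map Z L (\<lambda>_. const_path k0)"
  unfolding continuous_map_loop_space
  by (intro conjI ballI continuous_map_const_path k0) (simp_all add: const_path_def)

lemma continuous_map_fiber_incl: "continuous_map L Q incl"
proof -
  have "continuous_map L (path_space K) (\<lambda>\<omega>. \<omega>)" "\<forall>\<omega>\<in>topspace L. \<omega> 0 = k0 \<and> \<omega> 1 = k0"
    using continuous_map_ident[of L] unfolding continuous_map_loop_space by simp_all
  then show ?thesis
    using continuous_map_funspace[OF p] e0 base
    by (auto simp: continuous_map_into_pullback fiber_incl_def)
qed

lemma pullback_EG_projections:
  shows "continuous_map Q (path_space K) (\<lambda>q. snd (fst q))" and "continuous_map Q EG snd"
    and "\<And>q. q \<in> topspace Q \<Longrightarrow> fst (fst q) = p (snd q)"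
    and "\<And>q. q \<in> topspace Q \<Longrightarrow> snd (fst q) 0 = lam (p (snd q)) \<and> snd (fst q) 1 = k0"
  using continuous_map_ident[of Q] unfolding continuous_map_into_pullback by auto

abbreviation "push \<gamma> \<equiv> map_path lam (map_path p \<gamma>)"

lemma push_at: "t \<in> {0..1} \<Longrightarrow> push \<gamma> t = lam (p (\<gamma> t))"
  by (simp add: map_path_def)

lemma continuous_map_push:
  "continuous_map Z (path_space EG) w \<Longrightarrow> continuous_map Z (path_space K) (\<lambda>z. push (w z))"
  by (intro continuous_map_map_path[OF lam] continuous_map_map_path[OF p])

text \<open>Over the contractible space \<open>EG\<close>, every point \<open>(e, \<gamma>)\<close> of \<open>Q\<close> is carried to the fiber over \<open>e0\<close> by
  prefixing \<open>\<gamma>\<close> with the image of a path from \<open>e0\<close> to \<open>e\<close>.\<close>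

lemma homotopy_inverse_fiber_incl_exists:
  assumes "contractible_space EG"
  obtains r where "homotopy_inverse L Q incl r"
proof -
  obtain C D where C: "continuous_map EG (path_space EG) C"
    and C01: "\<And>x. x \<in> topspace EG \<Longrightarrow> C x 0 = e0 \<and> C x 1 = x"
    and D: "continuous_map (top_of_set {0..1::real}) (path_space EG) D"
    and D0: "D 0 = C e0" and D1: "D 1 = const_path e0" and D01: "\<And>t. D t 0 = e0 \<and> D t 1 = e0"
    by (rule based_contraction[OF assms e0]) (rule that)
  define r where "r q = path_concat (push (C (snd q))) (snd (fst q))" for q :: "('b \<times> (real \<Rightarrow> 'k)) \<times> 'e"
  note proj = pullback_EG_projections
  have snd_EG: "snd q \<in> topspace EG" if "q \<in> topspace Q" for q
    using continuous_map_funspace[OF proj(2)] that by blast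
  have r: "continuous_map Q L r"
    unfolding r_def continuous_map_loop_space
  proof (intro conjI ballI continuous_map_path_concat proj(1))
    show "continuous_map Q (path_space K) (\<lambda>q. push (C (snd q)))"
      by (rule continuous_map_push[OF continuous_map_comp[OF C proj(2)]])
  qed (simp_all add: push_at snd_EG C01 proj(4) base)
  have "homotopic_with (\<lambda>_. True) Q Q (incl \<circ> r) id"
  proof (rule homotopic_mapsI)
    \<comment> \<open>Move the base point along \<open>C e\<close>. The path over it is the part of \<open>r q\<close> that starts there;
      \<open>C e\<close> occupies only the first half of \<open>r q\<close>, hence \<open>t/2\<close>.\<close>
    define h where "h t q = ((p (C (snd q) t), path_tail (t/2) (r q)), C (snd q) t)"
      for t :: real and q :: "('b \<times> (real \<Rightarrow> 'k)) \<times> 'e"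
    let ?IQ = "prod_topology (top_of_set {0..1::real}) Q"
    have Ct: "continuous_map ?IQ EG (\<lambda>z. C (snd (snd z)) (fst z))"
      by (rule continuous_map_path_eval[OF continuous_map_comp[OF C continuous_map_comp[OF proj(2)
            continuous_map_snd]] continuous_map_unit_interval_fst]) auto
    have rt: "continuous_map ?IQ (path_space K) (\<lambda>z. path_tail (fst z / 2) (r (snd z)))"
    proof (rule continuous_map_path_tail)
      show "continuous_map ?IQ euclideanreal (\<lambda>z. fst z / 2)"
        by (intro continuous_intros continuous_map_unit_interval_fst) auto
      show "continuous_map ?IQ (path_space K) (\<lambda>z. r (snd z))"
        by (rule continuous_map_comp[OF r[unfolded continuous_map_loop_space, THEN conjunct1]
              continuous_map_snd])
    qed auto
    have "r q (t/2) = lam (p (C (snd q) t))" if "t \<in> {0..1}" for q t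
      using that by (simp add: r_def path_concat_def push_at)
    moreover have "r q 1 = k0" if "q \<in> topspace Q" for q
      using that by (simp add: r_def proj(4))
    ultimately show "continuous_map ?IQ Q (\<lambda>z. h (fst z) (snd z))"
      using continuous_map_comp[OF p Ct] Ct rt
      by (simp add: continuous_map_into_pullback h_def)
    fix q assume q: "q \<in> topspace Q"
    have rq: "r q \<in> extensional {0..1}"
      by (simp add: r_def)
    show "h 0 q = (incl \<circ> r) q"
      using q by (simp add: h_def fiber_incl_def snd_EG C01 path_tail_0[OF rq])
    have "path_tail (1/2) (r q) = snd (fst q)"
      unfolding r_def
      by (rule path_tail_half_concat)
        (use path_space_memD(1)[OF proj(1) q] q in \<open>simp_all add: push_at snd_EG C01 proj(4)\<close>)
    then show "h 1 q = id q"
      using q by (simp add: h_def snd_EG C01 proj(3)[symmetric])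
  qed
  moreover have "homotopic_with (\<lambda>_. True) L L (r \<circ> incl) id"
  proof (rule homotopic_with_trans)
    let ?IL = "prod_topology (top_of_set {0..1::real}) L"
    have L: "continuous_map ?IL (path_space K) snd"
      "\<forall>z\<in>topspace ?IL. snd z 0 = k0 \<and> snd z 1 = k0"
      using continuous_map_snd[of "top_of_set {0..1::real}" L]
      unfolding continuous_map_loop_space by simp_all
    \<comment> \<open>Over \<open>e0\<close>, the prefix is the image of the null-homotopic loop \<open>C e0\<close>, contracted by \<open>D\<close>.\<close>
    show "homotopic_with (\<lambda>_. True) L L (r \<circ> incl) (\<lambda>\<omega>. path_concat (const_path k0) \<omega>)"
    proof (rule homotopic_mapsI)
      show "continuous_map ?IL L (\<lambda>z. path_concat (push (D (fst z))) (snd z))"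
        unfolding continuous_map_loop_space
      proof (intro conjI ballI continuous_map_path_concat L(1))
        show "continuous_map ?IL (path_space K) (\<lambda>z. push (D (fst z)))"
          by (rule continuous_map_push[OF continuous_map_comp[OF D continuous_map_fst]])
      qed (use L(2) in \<open>auto simp: push_at D01 base\<close>)
      show "path_concat (push (D 1)) \<omega> = path_concat (const_path k0) \<omega>" for \<omega>
        by (auto simp: D1 const_path_def map_path_def path_concat_def base fun_eq_iff)
    qed (simp add: r_def fiber_incl_def D0)
    \<comment> \<open>The remaining constant prefix is the first half of the path and is cut off gradually.\<close>
    show "homotopic_with (\<lambda>_. True) L L (\<lambda>\<omega>. path_concat (const_path k0) \<omega>) id"
    proof (rule homotopic_mapsI)
      show "continuous_map ?IL L (\<lambda>z. path_tail (fst z / 2) (path_concat (const_path k0) (snd z)))"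
        unfolding continuous_map_loop_space
      proof (intro conjI ballI continuous_map_path_tail continuous_map_path_concat L(1)
          continuous_map_const_path k0)
        show "continuous_map ?IL euclideanreal (\<lambda>z. fst z / 2)"
          by (intro continuous_intros continuous_map_unit_interval_fst) auto
      qed (use L(2) in \<open>auto simp: const_path_def path_concat_def\<close>)
      fix \<omega> assume "\<omega> \<in> topspace L"
      then have "\<omega> \<in> extensional {0..1}" "\<omega> 0 = k0"
        by (auto simp: loop_space_def topspace_compact_open)
      then show "path_tail (1/2) (path_concat (const_path k0) \<omega>) = id \<omega>"
        by (simp add: path_tail_half_concat const_path_def)
    qed (simp add: path_tail_0)
  qed
  ultimately have "homotopy_inverse L Q incl r"
    using r continuous_map_fiber_incl by (simp add: homotopy_inverse_def)
  then show ?thesis by (rule that)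
qed

lemma homotopy_inverse_fiber_incl:
  assumes "homotopy_inverse L Q incl r"
  shows "continuous_map Q L r"
    and "homotopic_with (\<lambda>_. True) L L (\<lambda>\<omega>. r (incl \<omega>)) (\<lambda>\<omega>. \<omega>)"
    and "\<exists>h. continuous_map (prod_topology (top_of_set {0..1::real}) Q) Q (\<lambda>z. h (fst z) (snd z)) \<and>
          (\<forall>q. h 0 q = incl (r q)) \<and> (\<forall>q. h 1 q = q)"
proof -
  show "continuous_map Q L r" "homotopic_with (\<lambda>_. True) L L (\<lambda>\<omega>. r (incl \<omega>)) (\<lambda>\<omega>. \<omega>)"
    using assms by (simp_all add: homotopy_inverse_def o_def id_def)
  have "homotopic_with (\<lambda>_. True) Q Q (incl \<circ> r) id"
    using assms by (simp add: homotopy_inverse_def)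
  then obtain h where "continuous_map (prod_topology (top_of_set {0..1::real}) Q) Q (\<lambda>z. h (fst z) (snd z))"
    "h 0 = incl \<circ> r" "h 1 = id"
    by (rule homotopic_withE) (rule that)
  then show "\<exists>h. continuous_map (prod_topology (top_of_set {0..1::real}) Q) Q (\<lambda>z. h (fst z) (snd z)) \<and>
          (\<forall>q. h 0 q = incl (r q)) \<and> (\<forall>q. h 1 q = q)"
    by (intro exI[of _ h]) simp
qed

text \<open>Let \<open>q \<cdot> \<omega>\<close> be the action of a loop \<open>\<omega>\<close>. Since \<open>incl\<close> is strictly equivariant,
  \<open>r (q \<cdot> \<omega>) \<simeq> r (incl (r q) \<cdot> \<omega>) = r (incl (r q \<cdot> \<omega>)) \<simeq> r q \<cdot> \<omega>\<close>.\<close>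

lemma homotopy_inverse_loop_act:
  assumes r: "homotopy_inverse L Q incl r"
    and q: "continuous_map Z Q q" and \<phi>: "continuous_map Z L \<phi>"
  shows "homotopic_with (\<lambda>_. True) Z L (\<lambda>z. r (loop_act (q z) (\<phi> z))) (\<lambda>z. path_concat (r (q z)) (\<phi> z))"
proof -
  obtain h where h: "continuous_map (prod_topology (top_of_set {0..1::real}) Q) Q (\<lambda>z. h (fst z) (snd z))"
    and h0: "\<And>q. h 0 q = incl (r q)" and h1: "\<And>q. h 1 q = q"
    using homotopy_inverse_fiber_incl(3)[OF r] by blast
  note rc = homotopy_inverse_fiber_incl(1)[OF r]
  have "homotopic_with (\<lambda>_. True) Z Q (\<lambda>z. incl (path_concat (r (q z)) (\<phi> z))) (\<lambda>z. loop_act (q z) (\<phi> z))"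
  proof (rule homotopic_mapsI)
    have "continuous_map (prod_topology (top_of_set {0..1}) Z) Q (\<lambda>z. h (fst z) (q (snd z)))"
      by (rule continuous_map_homotopy_at[OF h continuous_map_unit_interval_fst
            continuous_map_comp[OF q continuous_map_snd]]) auto
    then show "continuous_map (prod_topology (top_of_set {0..1}) Z) Q
        (\<lambda>z. loop_act (h (fst z) (q (snd z))) (\<phi> (snd z)))"
      by (rule continuous_map_loop_act) (rule continuous_map_comp[OF \<phi> continuous_map_snd])
  qed (simp_all add: h0 h1 loop_act_fiber_incl)
  from homotopic_comp[OF rc this]
  have "homotopic_with (\<lambda>_. True) Z L (\<lambda>z. r (incl (path_concat (r (q z)) (\<phi> z))))
      (\<lambda>z. r (loop_act (q z) (\<phi> z)))" .
  moreover have "homotopic_with (\<lambda>_. True) Z L (\<lambda>z. r (incl (path_concat (r (q z)) (\<phi> z))))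
      (\<lambda>z. path_concat (r (q z)) (\<phi> z))"
    by (rule homotopic_precomp[OF homotopy_inverse_fiber_incl(2)[OF r]
          continuous_map_loop_space_path_concat[OF continuous_map_comp[OF rc q] \<phi>]])
  ultimately show ?thesis
    using homotopic_with_symD homotopic_with_trans by blast
qed

text \<open>All homotopy inverses of \<open>incl\<close> are homotopic, so one of them represents the canonical class.\<close>

lemma canonical_class_eq:
  assumes r: "homotopy_inverse L Q incl r" and E: "continuous_map P Q (equivariant_lift \<pi> F s)"
  shows "canonical_class P \<pi> EG e0 p BG lam K k0 F s
    = htpy_class (\<lambda>_. True) P L (\<lambda>x. r (equivariant_lift \<pi> F s x))"
proof -
  have "htpy_class (\<lambda>_. True) P L (r' \<circ> equivariant_lift \<pi> F s)
      = htpy_class (\<lambda>_. True) P L (\<lambda>x. r (equivariant_lift \<pi> F s x))"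
    if "homotopy_inverse L Q incl r'" for r'
    using homotopic_precomp[OF homotopy_inverse_unique[OF that r] E]
    by (intro htpy_class_eqI) (simp add: o_def)
  then show ?thesis
    using r unfolding canonical_class_def by blast
qed

end

locale pulled_back_bundle = pulled_back_path_fibration EG p BG lam K k0 e0
  for EG :: "'e topology" and p :: "'e \<Rightarrow> 'b" and BG :: "'b topology" and lam :: "'b \<Rightarrow> 'k"
    and K :: "'k topology" and k0 :: 'k and e0 :: 'e +
  fixes TG :: "'g topology" and actE :: "'e \<Rightarrow> 'g \<Rightarrow> 'e"
  assumes actE: "continuous_map (prod_topology EG TG) EG (\<lambda>z. actE (fst z) (snd z))"
    and p_actE: "\<And>e g. e \<in> topspace EG \<Longrightarrow> g \<in> topspace TG \<Longrightarrow> p (actE e g) = p e"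
begin

lemma continuous_map_group_act:
  assumes q: "continuous_map Z Q q" and g: "continuous_map Z TG g"
  shows "continuous_map Z Q (\<lambda>z. group_act actE (q z) (g z))"
proof -
  have e: "continuous_map Z EG (\<lambda>z. snd (q z))"
    using q by (simp add: continuous_map_pullback_EG)
  have "continuous_map Z EG (\<lambda>z. actE (snd (q z)) (g z))"
    using continuous_map_comp[OF actE, of Z "\<lambda>z. (snd (q z), g z)"] e g
    by (simp add: continuous_map_paired)
  moreover have "p (actE (snd (q z)) (g z)) = p (snd (q z))" if "z \<in> topspace Z" for z
    using continuous_map_funspace[OF e] continuous_map_funspace[OF g] that by (intro p_actE) auto
  ultimately show ?thesis
    using q by (simp add: continuous_map_pullback_EG group_act_def)
qed

lemma orbits_homotopic_along_path:
  assumes "continuous_map (top_of_set {0..1::real}) Q \<eta>"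
  shows "homotopic_with (\<lambda>_. True) TG Q (group_act actE (\<eta> 0)) (group_act actE (\<eta> 1))"
proof (rule homotopic_mapsI)
  show "continuous_map (prod_topology (top_of_set {0..1}) TG) Q (\<lambda>z. group_act actE (\<eta> (fst z)) (snd z))"
    by (rule continuous_map_group_act[OF continuous_map_comp[OF assms continuous_map_fst] continuous_map_snd])
qed simp_all

text \<open>A path in \<open>Q\<close> from \<open>q\<close> to the constant loop: first to the loop \<open>r q\<close> in the fiber over \<open>e0\<close>, along
  the homotopy from \<open>incl \<circ> r\<close> to the identity, and then along a null-homotopy of \<open>r q\<close> in \<open>K\<close>.\<close>

lemma orbits_homotopic_to_base_orbit:
  assumes r: "homotopy_inverse L Q incl r" and triv: "trivial_group (homotopy_group 1 K k0)"
    and q: "q \<in> topspace Q"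
  shows "homotopic_with (\<lambda>_. True) TG Q (group_act actE q) (group_act actE (incl (const_path k0)))"
proof -
  obtain h where h: "continuous_map (prod_topology (top_of_set {0..1::real}) Q) Q (\<lambda>z. h (fst z) (snd z))"
    and h0: "\<And>q. h 0 q = incl (r q)" and h1: "\<And>q. h 1 q = q"
    using homotopy_inverse_fiber_incl(3)[OF r] by blast
  have "continuous_map (top_of_set {0..1}) Q (\<lambda>t. h t q)"
    by (rule continuous_map_homotopy_at[OF h]) (use q in auto)
  from orbits_homotopic_along_path[OF this]
  have 1: "homotopic_with (\<lambda>_. True) TG Q (group_act actE (incl (r q))) (group_act actE q)"
    by (simp add: h0 h1)
  have "r q \<in> topspace L"
    using continuous_map_funspace[OF homotopy_inverse_fiber_incl(1)[OF r]] q by blast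
  then obtain \<eta> where \<eta>: "continuous_map (top_of_set {0..1::real}) L \<eta>"
    and \<eta>0: "\<eta> 0 = r q" and \<eta>1: "\<eta> 1 = const_path k0"
    by (rule null_loop[OF triv])
  from orbits_homotopic_along_path[OF continuous_map_comp[OF continuous_map_fiber_incl \<eta>]]
  have "homotopic_with (\<lambda>_. True) TG Q (group_act actE (incl (r q)))
      (group_act actE (incl (const_path k0)))"
    by (simp add: \<eta>0 \<eta>1)
  with 1 show ?thesis
    using homotopic_with_symD homotopic_with_trans by blast
qed

text \<open>At time \<open>t\<close>, take the point \<open>c g t\<close> of \<open>EG\<close> together with the part of the loop \<open>push (c g)\<close> from
  time \<open>t\<close> on. At time 1 only the constant path over \<open>e0 g\<close> is left.\<close>

lemma orbit_path_loops_homotopic_to_base_orbit: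
  assumes c: "orbit_paths TG EG actE e0 c"
  shows "homotopic_with (\<lambda>_. True) TG Q (\<lambda>g. incl (push (c g))) (group_act actE (incl (const_path k0)))"
proof (rule homotopic_mapsI)
  define h where "h t g = ((p (c g t), path_tail t (push (c g))), c g t)" for t g
  have cc: "continuous_map TG (path_space EG) c" and c01: "\<And>g. g \<in> topspace TG \<Longrightarrow> c g 0 = e0 \<and> c g 1 = actE e0 g"
    using c by (auto simp: orbit_paths_def)
  let ?IG = "prod_topology (top_of_set {0..1::real}) TG"
  have ct: "continuous_map ?IG EG (\<lambda>z. c (snd z) (fst z))"
    by (rule continuous_map_path_eval[OF continuous_map_comp[OF cc continuous_map_snd]
          continuous_map_unit_interval_fst]) auto
  have "continuous_map ?IG (path_space K) (\<lambda>z. path_tail (fst z) (push (c (snd z))))"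
    by (rule continuous_map_path_tail[OF continuous_map_unit_interval_fst
          continuous_map_comp[OF continuous_map_push[OF cc] continuous_map_snd]]) auto
  moreover have "push (c g) 1 = k0" if "g \<in> topspace TG" for g
    using that by (simp add: push_at c01 p_actE e0 base)
  ultimately show "continuous_map ?IG Q (\<lambda>z. h (fst z) (snd z))"
    using continuous_map_comp[OF p ct] ct
    by (auto simp: continuous_map_into_pullback h_def push_at)
  fix g assume g: "g \<in> topspace TG"
  have "push (c g) \<in> extensional {0..1}"
    by (simp add: map_path_def)
  then show "h 0 g = incl (push (c g))"
    using g by (simp add: h_def c01 path_tail_0 fiber_incl_def)
  show "h 1 g = group_act actE (incl (const_path k0)) g"
    using g by (simp add: h_def c01 path_tail_1 push_at p_actE e0 base group_act_def fiber_incl_def)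
qed

text \<open>Applying \<open>r\<close> to the preceding homotopy turns \<open>incl (push (c g))\<close> back into \<open>push (c g)\<close>, whatever
  the choice \<open>c\<close> of orbit paths is. A contraction of \<open>EG\<close> shows that such a choice exists.\<close>

lemma Omega_class_eq:
  assumes EG: "contractible_space EG" and r: "homotopy_inverse L Q incl r"
  shows "Omega_class TG EG actE e0 p lam K k0
    = htpy_class (\<lambda>_. True) TG L (\<lambda>g. r (group_act actE (incl (const_path k0)) g))"
proof -
  have "htpy_class (\<lambda>_. True) TG L (\<lambda>g. push (c g))
      = htpy_class (\<lambda>_. True) TG L (\<lambda>g. r (group_act actE (incl (const_path k0)) g))"
    if c: "orbit_paths TG EG actE e0 c" for c
  proof (rule htpy_class_eqI)
    have "continuous_map TG L (\<lambda>g. push (c g))"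
      using c continuous_map_push[of TG c]
      by (auto simp: orbit_paths_def continuous_map_loop_space push_at p_actE e0 base)
    from homotopic_precomp[OF homotopy_inverse_fiber_incl(2)[OF r] this]
    have "homotopic_with (\<lambda>_. True) TG L (\<lambda>g. r (incl (push (c g)))) (\<lambda>g. push (c g))" .
    moreover have "homotopic_with (\<lambda>_. True) TG L (\<lambda>g. r (incl (push (c g))))
        (\<lambda>g. r (group_act actE (incl (const_path k0)) g))"
      by (rule homotopic_comp[OF homotopy_inverse_fiber_incl(1)[OF r]
            orbit_path_loops_homotopic_to_base_orbit[OF c]])
    ultimately show "homotopic_with (\<lambda>_. True) TG L (\<lambda>g. push (c g))
        (\<lambda>g. r (group_act actE (incl (const_path k0)) g))"
      using homotopic_with_symD homotopic_with_trans by blast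
  qed
  moreover obtain C D where C: "continuous_map EG (path_space EG) C"
    and C01: "\<And>x. x \<in> topspace EG \<Longrightarrow> C x 0 = e0 \<and> C x 1 = x"
    and "continuous_map (top_of_set {0..1::real}) (path_space EG) D"
    and "D 0 = C e0" "D 1 = const_path e0" "\<And>t. D t 0 = e0 \<and> D t 1 = e0"
    by (rule based_contraction[OF EG e0]) (rule that)
  have a: "continuous_map TG EG (\<lambda>g. actE e0 g)"
    using continuous_map_comp[OF actE, of TG "\<lambda>g. (e0, g)"] e0
    by (simp add: continuous_map_paired continuous_map_ident)
  have "orbit_paths TG EG actE e0 (\<lambda>g. C (actE e0 g))"
    using continuous_map_comp[OF C a] continuous_map_funspace[OF a] C01
    by (auto simp: orbit_paths_def)
  ultimately show ?thesis
    unfolding Omega_class_def by blast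
qed

end


section \<open>Bundles, trivializations and actions\<close>

text \<open>The right translates of \<open>x\<close> stay in its fiber because a local trivialization \<open>\<phi>\<close> intertwines
  right translation on \<open>G\<close> with the action.\<close>

lemma principal_bundle_proj_act:
  assumes G: "topological_group G TG" and pb: "principal_bundle G TG P act M \<pi>"
    and x: "x \<in> topspace P" and g: "g \<in> carrier G"
  shows "\<pi> (act x g) = \<pi> x"
proof -
  interpret group G
    using G by (simp add: topological_group_def)
  have TG: "topspace TG = carrier G"
    using G by (simp add: topological_group_def)
  have "\<pi> x \<in> topspace M"
    using pb x continuous_map_funspace unfolding principal_bundle_def by blast
  then obtain U \<phi> where U: "openin M U" "\<pi> x \<in> U"
    and hom: "homeomorphic_map (prod_topology (subtopology M U) TG)
          (subtopology P {x \<in> topspace P. \<pi> x \<in> U}) \<phi>"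
    and \<phi>: "\<And>u g. u \<in> U \<Longrightarrow> g \<in> carrier G \<Longrightarrow> \<pi> (\<phi> (u, g)) = u \<and>
           (\<forall>h\<in>carrier G. \<phi> (u, g \<otimes>\<^bsub>G\<^esub> h) = act (\<phi> (u, g)) h)"
    using pb unfolding principal_bundle_def by meson
  have "x \<in> \<phi> ` topspace (prod_topology (subtopology M U) TG)"
    using homeomorphic_imp_surjective_map[OF hom] x U(2) by simp
  then obtain u h where uh: "u \<in> U" "h \<in> carrier G" "x = \<phi> (u, h)"
    using TG by auto
  then have "\<pi> (act x g) = \<pi> (\<phi> (u, h \<otimes>\<^bsub>G\<^esub> g))"
    using \<phi> g by simp
  also have "\<dots> = u"
    using \<phi>[OF uh(1) m_closed[OF uh(2) g]] by blast
  finally show ?thesis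
    using \<phi>[OF uh(1,2)] uh(3) by simp
qed

lemma continuous_map_orbit:
  assumes "principal_bundle G TG P act M \<pi>" and "x \<in> topspace P"
  shows "continuous_map TG P (act x)"
proof -
  have 1: "continuous_map TG (prod_topology P TG) (\<lambda>g. (x, g))"
    using assms(2) by (simp add: continuous_map_paired continuous_map_ident)
  have 2: "continuous_map (prod_topology P TG) P (\<lambda>(x, g). act x g)"
    using assms(1) by (simp add: principal_bundle_def)
  show ?thesis
    using continuous_map_comp[OF 2 1] by simp
qed

lemma continuous_map_equivariant_lift:
  assumes "continuous_map P M \<pi>" and "classified_by G P act M \<pi> EG actE BG p f F"
    and "trivialization M f BG lam K k0 s"
  shows "continuous_map P (pullback_EG EG p BG lam K k0) (equivariant_lift \<pi> F s)"
proof -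
  have "continuous_map P (homotopy_fiber BG lam K k0) (\<lambda>x. s (\<pi> x))"
    using assms continuous_map_comp unfolding trivialization_def by blast
  moreover have "fst (s (\<pi> x)) = p (F x)" if "x \<in> topspace P" for x
    using assms that continuous_map_funspace[OF assms(1)]
    by (auto simp: trivialization_def is_lift_def classified_by_def)
  ultimately show ?thesis
    using assms(2) by (simp add: continuous_map_pullback_EG equivariant_lift_def classified_by_def)
qed

lemma homotopic_equivariant_lifts:
  assumes \<pi>: "continuous_map P M \<pi>" and cl: "classified_by G P act M \<pi> EG actE BG p f F"
    and "triv_homotopic M f BG lam K k0 s s'"
  shows "homotopic_with (\<lambda>_. True) P (pullback_EG EG p BG lam K k0)
    (equivariant_lift \<pi> F s) (equivariant_lift \<pi> F s')"
proof -
  obtain h where h: "continuous_map (prod_topology (top_of_set {0..1::real}) M)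
        (homotopy_fiber BG lam K k0) (\<lambda>z. h (fst z) (snd z))"
    and h0: "h 0 = s" and h1: "h 1 = s'" and lift: "\<And>t. t \<in> {0..1} \<Longrightarrow> is_lift M f (h t)"
    using assms(3) unfolding triv_homotopic_def by (rule homotopic_withE) (rule that)
  show ?thesis
  proof (rule homotopic_mapsI)
    let ?IP = "prod_topology (top_of_set {0..1::real}) P"
    have "continuous_map ?IP (homotopy_fiber BG lam K k0) (\<lambda>z. h (fst z) (\<pi> (snd z)))"
      by (rule continuous_map_homotopy_at[OF h continuous_map_unit_interval_fst
            continuous_map_comp[OF \<pi> continuous_map_snd]]) auto
    moreover have "continuous_map ?IP EG (\<lambda>z. F (snd z))"
      using cl continuous_map_comp[OF _ continuous_map_snd] by (auto simp: classified_by_def)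
    moreover have "fst (h t (\<pi> x)) = p (F x)" if "t \<in> {0..1}" "x \<in> topspace P" for t x
      using lift[OF that(1)] that(2) cl continuous_map_funspace[OF \<pi>]
      by (auto simp: is_lift_def classified_by_def)
    ultimately show "continuous_map ?IP (pullback_EG EG p BG lam K k0)
        (\<lambda>z. equivariant_lift \<pi> F (h (fst z)) (snd z))"
      by (auto simp: continuous_map_pullback_EG equivariant_lift_def)
  qed (simp_all add: h0 h1)
qed

lemma homotopic_path_concat:
  assumes "homotopic_with (\<lambda>_. True) X (loop_space Y y1) u u'"
    and "homotopic_with (\<lambda>_. True) X (loop_space Y y1) v v'"
  shows "homotopic_with (\<lambda>_. True) X (loop_space Y y1)
    (\<lambda>x. path_concat (u x) (v x)) (\<lambda>x. path_concat (u' x) (v' x))"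
proof -
  obtain h where h: "continuous_map (prod_topology (top_of_set {0..1::real}) X) (loop_space Y y1)
        (\<lambda>z. h (fst z) (snd z))" and h01: "h 0 = u" "h 1 = u'"
    using assms(1) by (rule homotopic_withE) (rule that)
  obtain k where k: "continuous_map (prod_topology (top_of_set {0..1::real}) X) (loop_space Y y1)
        (\<lambda>z. k (fst z) (snd z))" and k01: "k 0 = v" "k 1 = v'"
    using assms(2) by (rule homotopic_withE) (rule that)
  show ?thesis
    by (rule homotopic_mapsI[where h = "\<lambda>t x. path_concat (h t x) (k t x)"])
      (simp_all add: h01 k01 continuous_map_loop_space_path_concat[OF h k])
qed

lemma homotopic_fiber_act:
  assumes "triv_homotopic M f BG lam K k0 s s'"
    and "homotopic_with (\<lambda>_. True) M (loop_space K k0) \<phi> \<phi>'"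
  shows "triv_homotopic M f BG lam K k0 (\<lambda>m. fiber_act (s m) (\<phi> m)) (\<lambda>m. fiber_act (s' m) (\<phi>' m))"
proof -
  obtain h where h: "continuous_map (prod_topology (top_of_set {0..1::real}) M)
        (homotopy_fiber BG lam K k0) (\<lambda>z. h (fst z) (snd z))"
    and h01: "h 0 = s" "h 1 = s'" and lift: "\<And>t. t \<in> {0..1} \<Longrightarrow> is_lift M f (h t)"
    using assms(1) unfolding triv_homotopic_def by (rule homotopic_withE) (rule that)
  obtain k where k: "continuous_map (prod_topology (top_of_set {0..1::real}) M) (loop_space K k0)
        (\<lambda>z. k (fst z) (snd z))" and k01: "k 0 = \<phi>" "k 1 = \<phi>'"
    using assms(2) by (rule homotopic_withE) (rule that)
  show ?thesis
    unfolding triv_homotopic_def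
  proof (rule homotopic_withI)
    show "continuous_map (prod_topology (top_of_set {0..1::real}) M) (homotopy_fiber BG lam K k0)
        (\<lambda>z. fiber_act (h (fst z) (snd z)) (k (fst z) (snd z)))"
      by (rule continuous_map_fiber_act[OF h k])
    show "is_lift M f (\<lambda>m. fiber_act (h t m) (k t m))" if "t \<in> {0..1}" for t
      using lift[OF that] by (simp add: is_lift_def fiber_act_def)
  qed (simp_all add: h01 k01 is_lift_def)
qed

lemma cohomology_mult_classes:
  assumes u: "continuous_map X (loop_space K k0) u" and v: "continuous_map X (loop_space K k0) v"
  shows "htpy_class (\<lambda>_. True) X (loop_space K k0) u \<otimes>\<^bsub>cohomology K k0 X\<^esub>
      htpy_class (\<lambda>_. True) X (loop_space K k0) v
    = htpy_class (\<lambda>_. True) X (loop_space K k0) (\<lambda>x. path_concat (u x) (v x))"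
  unfolding cohomology_def monoid.simps
proof (rule UN_htpy_class_eq[OF u TrueI], rule UN_htpy_class_eq[OF v TrueI])
  fix u' v' assume "homotopic_with (\<lambda>_. True) X (loop_space K k0) u u'"
    and "homotopic_with (\<lambda>_. True) X (loop_space K k0) v v'"
  from homotopic_path_concat[OF this, THEN htpy_class_eqI]
  show "htpy_class (\<lambda>_. True) X (loop_space K k0) (\<lambda>x. path_concat (u' x) (v' x))
      = htpy_class (\<lambda>_. True) X (loop_space K k0) (\<lambda>x. path_concat (u x) (v x))" ..
qed

lemma htpy_class_in_cohomology:
  "continuous_map X (loop_space K k0) u \<Longrightarrow>
    htpy_class (\<lambda>_. True) X (loop_space K k0) u \<in> carrier (cohomology K k0 X)"
  by (auto simp: cohomology_def htpy_classes_def)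

lemma triv_act_classes:
  assumes s: "trivialization M f BG lam K k0 s" and \<phi>: "continuous_map M (loop_space K k0) \<phi>"
  shows "triv_act M f BG lam K k0 (htpy_class (\<lambda>_. True) M (loop_space K k0) \<phi>)
      (htpy_class (is_lift M f) M (homotopy_fiber BG lam K k0) s)
    = htpy_class (is_lift M f) M (homotopy_fiber BG lam K k0) (\<lambda>m. fiber_act (s m) (\<phi> m))"
  unfolding triv_act_def
proof (rule UN_htpy_class_eq[OF \<phi> TrueI], rule UN_htpy_class_eq)
  fix \<phi>' s' assume "homotopic_with (\<lambda>_. True) M (loop_space K k0) \<phi> \<phi>'"
    and "homotopic_with (is_lift M f) M (homotopy_fiber BG lam K k0) s s'"
  then have "triv_homotopic M f BG lam K k0 (\<lambda>m. fiber_act (s m) (\<phi> m)) (\<lambda>m. fiber_act (s' m) (\<phi>' m))"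
    by (intro homotopic_fiber_act) (simp_all add: triv_homotopic_def)
  from htpy_class_eqI[OF this[unfolded triv_homotopic_def]]
  show "htpy_class (is_lift M f) M (homotopy_fiber BG lam K k0) (\<lambda>m. fiber_act (s' m) (\<phi>' m))
      = htpy_class (is_lift M f) M (homotopy_fiber BG lam K k0) (\<lambda>m. fiber_act (s m) (\<phi> m))" ..
qed (use s in \<open>simp_all add: trivialization_def\<close>)

lemma trivialization_fiber_act:
  assumes "trivialization M f BG lam K k0 s" and "continuous_map M (loop_space K k0) \<phi>"
  shows "trivialization M f BG lam K k0 (\<lambda>m. fiber_act (s m) (\<phi> m))"
  using assms continuous_map_fiber_act by (auto simp: trivialization_def is_lift_def fiber_act_def)


section \<open>The canonical class\<close>

theorem proposition2p3:
  fixes G :: "('g, 'gx) monoid_scheme" and TG :: "'g topology" and W :: "'w topology"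
    and H :: "('h, 'hx) monoid_scheme" and n :: nat
    and K :: "'k topology" and k0 :: 'k
    and EG :: "'e topology" and actE :: "'e \<Rightarrow> 'g \<Rightarrow> 'e" and e0 :: 'e
    and BG :: "'b topology" and p :: "'e \<Rightarrow> 'b" and lam :: "'b \<Rightarrow> 'k"
    and M :: "'m topology" and P :: "'p topology" and act :: "'p \<Rightarrow> 'g \<Rightarrow> 'p" and \<pi> :: "'p \<Rightarrow> 'm"
    and f :: "'m \<Rightarrow> 'b" and F :: "'p \<Rightarrow> 'e"
  assumes "topological_group G TG" and "connected_space TG"
    and "CW_complex W" and "TG homotopy_equivalent_space W"
    and "comm_group H" and "n \<ge> 2" and "eilenberg_maclane H n K k0"
    and "universal_bundle G TG EG actE BG p" and "e0 \<in> topspace EG"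
    and "continuous_map BG K lam" and "lam (p e0) = k0"
    and "CW_complex M" and "connected_space M"
    and "principal_bundle G TG P act M \<pi>"
    and "classified_by G P act M \<pi> EG actE BG p f F"
  shows
    "(\<forall>s. trivialization M f BG lam K k0 s \<longrightarrow>
        canonical_class P \<pi> EG e0 p BG lam K k0 F s \<in> carrier (cohomology K k0 P) \<and>
        Omega_class TG EG actE e0 p lam K k0 \<in> carrier (cohomology K k0 TG) \<and>
        (\<forall>x0\<in>topspace P.
           htpy_pullback TG (loop_space K k0) (act x0)
             (canonical_class P \<pi> EG e0 p BG lam K k0 F s)
           = Omega_class TG EG actE e0 p lam K k0)) \<and>
     (\<forall>s s'. trivialization M f BG lam K k0 s \<and> trivialization M f BG lam K k0 s' \<and>
        triv_homotopic M f BG lam K k0 s s' \<longrightarrow>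
        canonical_class P \<pi> EG e0 p BG lam K k0 F s
        = canonical_class P \<pi> EG e0 p BG lam K k0 F s') \<and>
     (\<forall>\<Phi>\<in>carrier (cohomology K k0 M). \<forall>T\<in>triv_classes M f BG lam K k0.
        triv_act M f BG lam K k0 \<Phi> T \<in> triv_classes M f BG lam K k0 \<and>
        htpy_pullback P (loop_space K k0) \<pi> \<Phi> \<in> carrier (cohomology K k0 P) \<and>
        canonical_assignment P \<pi> EG e0 p BG lam K k0 F (triv_act M f BG lam K k0 \<Phi> T)
        = canonical_assignment P \<pi> EG e0 p BG lam K k0 F T
            \<otimes>\<^bsub>cohomology K k0 P\<^esub> htpy_pullback P (loop_space K k0) \<pi> \<Phi>)"
proof -
  note G = assms(1)
  have pbE: "principal_bundle G TG EG actE BG p" and EG: "contractible_space EG"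
    using assms(8) by (simp_all add: universal_bundle_def)
  have TG: "topspace TG = carrier G"
    using G by (simp add: topological_group_def)
  interpret pulled_back_bundle EG p BG lam K k0 e0 TG actE
  proof
    show "continuous_map EG BG p"
      using pbE by (simp add: principal_bundle_def)
    show "continuous_map (prod_topology EG TG) EG (\<lambda>z. actE (fst z) (snd z))"
      using pbE by (simp add: principal_bundle_def split_def)
    show "p (actE e g) = p e" if "e \<in> topspace EG" "g \<in> topspace TG" for e g
      using principal_bundle_proj_act[OF G pbE that(1)] that(2) TG by simp
  qed (use assms in auto)
  \<comment> \<open>Here \<open>n \<noteq> 1\<close> makes \<open>K\<close> simply connected.\<close>
  have triv: "trivial_group (homotopy_group 1 K k0)"
    using assms(6,7) unfolding eilenberg_maclane_def by simp
  obtain r where r: "homotopy_inverse L Q incl r"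
    using homotopy_inverse_fiber_incl_exists[OF EG] .
  note rc = homotopy_inverse_fiber_incl(1)[OF r]
  note pb = assms(14) and cl = assms(15)
  have \<pi>: "continuous_map P M \<pi>"
    using pb by (simp add: principal_bundle_def)
  let ?E = "equivariant_lift \<pi> F"
  let ?hf = "homotopy_fiber BG lam K k0"
  let ?class = "canonical_class P \<pi> EG e0 p BG lam K k0 F"
  let ?assignment = "canonical_assignment P \<pi> EG e0 p BG lam K k0 F"
  let ?\<Omega> = "Omega_class TG EG actE e0 p lam K k0"
  let ?base_orbit = "\<lambda>g. r (group_act actE (incl (const_path k0)) g)"
  note E = continuous_map_equivariant_lift[OF \<pi> cl]
  note class_eq = canonical_class_eq[OF r E]
  note \<Omega>_eq = Omega_class_eq[OF EG r]
  have base_orbit: "continuous_map TG L ?base_orbit"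
    by (rule continuous_map_comp[OF rc continuous_map_group_act[OF
            continuous_map_comp[OF continuous_map_fiber_incl continuous_map_const_loop] continuous_map_ident]])
  have class_cong: "?class s = ?class s'" if "triv_homotopic M f BG lam K k0 s s'" for s s'
  proof -
    have "trivialization M f BG lam K k0 s" "trivialization M f BG lam K k0 s'"
      using that homotopic_with_imp_continuous_maps homotopic_with_imp_property
      unfolding triv_homotopic_def trivialization_def by blast+
    then show ?thesis
      using homotopic_comp[OF rc homotopic_equivariant_lifts[OF \<pi> cl that]]
      by (simp add: class_eq htpy_class_eqI)
  qed
  have fibers: "htpy_pullback TG L (act x0) (?class s) = ?\<Omega>"
    if s: "trivialization M f BG lam K k0 s" and x0: "x0 \<in> topspace P" for s x0
  proof -
    note orb = continuous_map_orbit[OF pb x0]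
    have "htpy_pullback TG L (act x0) (?class s)
        = htpy_class (\<lambda>_. True) TG L (\<lambda>g. r (?E s (act x0 g)))"
      using htpy_pullback_class[OF orb continuous_map_comp[OF rc E[OF s]]]
      by (simp add: class_eq[OF s] o_def)
    also have "\<dots> = ?\<Omega>"
      unfolding \<Omega>_eq
    proof (rule htpy_class_eqI, rule homotopic_comp[OF rc], rule homotopic_with_trans)
      show "homotopic_with (\<lambda>_. True) TG Q (\<lambda>g. ?E s (act x0 g)) (group_act actE (?E s x0))"
      proof (rule homotopic_with_equal)
        show "continuous_map TG Q (\<lambda>g. ?E s (act x0 g))"
          by (rule continuous_map_comp[OF E[OF s] orb])
        fix g assume "g \<in> topspace TG"
        then show "?E s (act x0 g) = group_act actE (?E s x0) g"
          using principal_bundle_proj_act[OF G pb x0] cl x0 TG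
          by (simp add: equivariant_lift_def group_act_def classified_by_def)
      qed simp_all
      show "homotopic_with (\<lambda>_. True) TG Q (group_act actE (?E s x0))
          (group_act actE (incl (const_path k0)))"
        using continuous_map_funspace[OF E[OF s]] x0
        by (intro orbits_homotopic_to_base_orbit[OF r triv]) blast
    qed
    finally show ?thesis .
  qed
  have equivariance: "triv_act M f BG lam K k0 \<Phi> T \<in> triv_classes M f BG lam K k0 \<and>
      htpy_pullback P L \<pi> \<Phi> \<in> carrier (cohomology K k0 P) \<and>
      ?assignment (triv_act M f BG lam K k0 \<Phi> T)
        = ?assignment T \<otimes>\<^bsub>cohomology K k0 P\<^esub> htpy_pullback P L \<pi> \<Phi>"
    if \<Phi>: "\<Phi> \<in> carrier (cohomology K k0 M)" and T: "T \<in> triv_classes M f BG lam K k0" for \<Phi> T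
  proof -
    obtain \<phi> where \<phi>: "continuous_map M L \<phi>" and \<Phi>_eq: "\<Phi> = htpy_class (\<lambda>_. True) M L \<phi>"
      using \<Phi> by (auto simp: cohomology_def htpy_classes_def)
    obtain s where s: "trivialization M f BG lam K k0 s" and T_eq: "T = htpy_class (is_lift M f) M ?hf s"
      using T by (auto simp: triv_classes_def htpy_classes_def trivialization_def)
    have assignment_eq: "?assignment (htpy_class (is_lift M f) M ?hf s') = ?class s'"
      if "trivialization M f BG lam K k0 s'" for s'
      unfolding canonical_assignment_def
      using that class_cong by (intro UN_htpy_class_eq) (auto simp: trivialization_def triv_homotopic_def)
    let ?s\<phi> = "\<lambda>m. fiber_act (s m) (\<phi> m)"
    note s\<phi> = trivialization_fiber_act[OF s \<phi>]
    have act_eq: "triv_act M f BG lam K k0 \<Phi> T = htpy_class (is_lift M f) M ?hf ?s\<phi>"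
      unfolding \<Phi>_eq T_eq by (rule triv_act_classes[OF s \<phi>])
    have pull_eq: "htpy_pullback P L \<pi> \<Phi> = htpy_class (\<lambda>_. True) P L (\<lambda>x. \<phi> (\<pi> x))"
      using htpy_pullback_class[OF \<pi> \<phi>] by (simp add: \<Phi>_eq o_def)
    note \<phi>\<pi> = continuous_map_comp[OF \<phi> \<pi>]
    have "?E ?s\<phi> = (\<lambda>x. loop_act (?E s x) (\<phi> (\<pi> x)))"
      by (simp add: equivariant_lift_def loop_act_def fun_eq_iff)
    then have "?class ?s\<phi> = htpy_class (\<lambda>_. True) P L (\<lambda>x. r (loop_act (?E s x) (\<phi> (\<pi> x))))"
      by (simp add: class_eq[OF s\<phi>])
    also have "\<dots> = htpy_class (\<lambda>_. True) P L (\<lambda>x. path_concat (r (?E s x)) (\<phi> (\<pi> x)))"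
      by (rule htpy_class_eqI[OF homotopy_inverse_loop_act[OF r E[OF s] \<phi>\<pi>]])
    also have "\<dots> = ?class s \<otimes>\<^bsub>cohomology K k0 P\<^esub> htpy_pullback P L \<pi> \<Phi>"
      unfolding class_eq[OF s] pull_eq
      by (rule cohomology_mult_classes[OF continuous_map_comp[OF rc E[OF s]] \<phi>\<pi>, symmetric])
    finally have main: "?class ?s\<phi> = ?class s \<otimes>\<^bsub>cohomology K k0 P\<^esub> htpy_pullback P L \<pi> \<Phi>" .
    show ?thesis
    proof (intro conjI)
      show "triv_act M f BG lam K k0 \<Phi> T \<in> triv_classes M f BG lam K k0"
        using s\<phi> unfolding act_eq triv_classes_def htpy_classes_def trivialization_def by blast
      show "htpy_pullback P L \<pi> \<Phi> \<in> carrier (cohomology K k0 P)"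
        unfolding pull_eq by (rule htpy_class_in_cohomology[OF \<phi>\<pi>])
      show "?assignment (triv_act M f BG lam K k0 \<Phi> T)
          = ?assignment T \<otimes>\<^bsub>cohomology K k0 P\<^esub> htpy_pullback P L \<pi> \<Phi>"
        unfolding act_eq unfolding T_eq assignment_eq[OF s\<phi>] assignment_eq[OF s] by (rule main)
    qed
  qed
  have class_carrier: "?class s \<in> carrier (cohomology K k0 P)" if s: "trivialization M f BG lam K k0 s" for s
    unfolding class_eq[OF s] by (rule htpy_class_in_cohomology[OF continuous_map_comp[OF rc E[OF s]]])
  have \<Omega>_carrier: "?\<Omega> \<in> carrier (cohomology K k0 TG)"
    unfolding \<Omega>_eq by (rule htpy_class_in_cohomology[OF base_orbit])
  show ?thesis
  proof (rule conjI[OF _ conjI])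
    show "\<forall>s. trivialization M f BG lam K k0 s \<longrightarrow>
        ?class s \<in> carrier (cohomology K k0 P) \<and> ?\<Omega> \<in> carrier (cohomology K k0 TG) \<and>
        (\<forall>x0\<in>topspace P. htpy_pullback TG L (act x0) (?class s) = ?\<Omega>)"
      by (intro allI impI conjI ballI class_carrier \<Omega>_carrier fibers)
    show "\<forall>s s'. trivialization M f BG lam K k0 s \<and> trivialization M f BG lam K k0 s' \<and>
        triv_homotopic M f BG lam K k0 s s' \<longrightarrow> ?class s = ?class s'"
      by (intro allI impI class_cong) (elim conjE)
  qed (intro ballI equivariance)
qed

end
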